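(* Let $0<\alpha<1$, $1<p<1/\alpha$ and let $q$ be defined by $\frac1p-\frac1q-\alpha=0$. (i) There is a constant $c>0$ depending only on $p$ and $\alpha$ such that for every $w\in A_{p,q}^+(\mathbb{R})$, $$\|M^{+}_{\alpha}\|_{L^p_{w^p}(\mathbb{R})\to L^q_{w^q}(\mathbb{R})}\le c\,\|w\|_{A_{p,q}^{+}(\mathbb{R})}^{\frac{p'}{q}(1-\alpha)},$$ and the exponent $\frac{p'}{q}(1-\alpha)$ is best possible: there is no positive non-decreasing function $\psi$ on $[1,\infty)$ with $\psi(t)/t^{\frac{p'}{q}(1-\alpha)}\to0$ as $t\to\infty$ such that $\|M_\alpha^+\|_{L^p_{w^p}\to L^q_{w^q}}\le\psi(\|w\|_{A_{p,q}^+(\mathbb{R})})$ for all $w\in A_{p,q}^+(\mathbb{R})$. (ii) There is a constant $c>0$ depending only on $p$ and $\alpha$ such that for every $w\in A_{p,q}^-(\mathbb{R})$, $$\|M^{-}_{\alpha}\|_{L^p_{w^p}(\mathbb{R})\to L^q_{w^q}(\mathbb{R})}\le c\,\|w\|_{A_{p,q}^{-}(\mathbb{R})}^{\frac{p'}{q}(1-\alpha)},$$ and the exponent $\frac{p'}{q}(1-\alpha)$ is best possible in the same sense (with $M_\alpha^-$ and $A_{p,q}^-$ in place of $M_\alpha^+$ and $A_{p,q}^+$).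
   Context: A weight on $\mathbb{R}$ is an a.e. positive locally integrable function. $p'=p/(p-1)$. $\|f\|_{L^r_u(\mathbb{R})}=\big(\int_{\mathbb{R}}|f|^r u\,dx\big)^{1/r}$, and $\|T\|_{X\to Y}=\sup_{\|f\|_X\le1}\|Tf\|_Y$. The one-sided fractional maximal operators are $$M_\alpha^{+}f(x)=\sup_{h>0}\frac1{h^{1-\alpha}}\int_x^{x+h}|f(t)|\,dt,\qquad M_\alpha^{-}f(x)=\sup_{h>0}\frac1{h^{1-\alpha}}\int_{x-h}^{x}|f(t)|\,dt .$$ For $1<p,q<\infty$, a weight $w$ belongs to $A_{p,q}^{\pm}(\mathbb{R})$ if the corresponding characteristic is finite: $$\|w\|_{A_{p,q}^+(\mathbb{R})}=\sup_{x\in\mathbb{R},h>0}\Big(\frac1h\int_{x-h}^x w^q\,dt\Big)\Big(\frac1h\int_x^{x+h}w^{-p'}dt\Big)^{q/p'},$$ $$\|w\|_{A_{p,q}^-(\mathbb{R})}=\sup_{x\in\mathbb{R},h>0}\Big(\frac1h\int_x^{x+h} w^q\,dt\Big)\Big(\frac1h\int_{x-h}^{x}w^{-p'}dt\Big)^{q/p'}.$$ *)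

theory Defs
  imports "HOL-Analysis.Analysis"
begin

text \<open>Norms, suprema and characteristics are formed in \<^typ>\<open>ennreal\<close>, so that the value \<open>\<infinity>\<close> is kept
  and no finiteness has to be presupposed.\<close>

text \<open>Real powers on \<open>[0, \<infinity>]\<close>. Only exponents \<open>r > 0\<close> are used, for which \<open>\<infinity>\<close> to the power \<open>r\<close>
  is \<open>\<infinity>\<close> and \<open>0\<close> to the power \<open>r\<close> is \<open>0\<close>.\<close>
definition ennpow :: "ennreal \<Rightarrow> real \<Rightarrow> ennreal" where
  "ennpow x r = (if x = \<infinity> then \<infinity> else ennreal (enn2real x powr r))"

definition conj_exp :: "real \<Rightarrow> real" where
  "conj_exp p = p / (p - 1)"

definition weight :: "(real \<Rightarrow> real) \<Rightarrow> bool" where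
  "weight w \<longleftrightarrow> w \<in> borel_measurable lebesgue \<and> (AE x in lebesgue. w x > 0)
     \<and> (\<forall>a b. set_integrable lebesgue {a..b} w)"

text \<open>The norm is defined for \<open>[0, \<infinity>]\<close>-valued functions because maximal functions may be infinite;
  for a real function \<open>f\<close> it is applied to \<open>\<bar>f\<bar>\<close>.\<close>
definition wnorm :: "real \<Rightarrow> (real \<Rightarrow> real) \<Rightarrow> (real \<Rightarrow> ennreal) \<Rightarrow> ennreal" where
  "wnorm r u F = ennpow (\<integral>\<^sup>+x. ennpow (F x) r * ennreal (u x) \<partial>lebesgue) (1 / r)"

definition op_norm ::
  "real \<Rightarrow> (real \<Rightarrow> real) \<Rightarrow> real \<Rightarrow> (real \<Rightarrow> real) \<Rightarrow> ((real \<Rightarrow> real) \<Rightarrow> real \<Rightarrow> ennreal) \<Rightarrow> ennreal" where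
  "op_norm p u q v T =
     (SUP f \<in> {f \<in> borel_measurable lebesgue. wnorm p u (\<lambda>x. ennreal \<bar>f x\<bar>) \<le> 1}. wnorm q v (T f))"

definition frac_max_plus :: "real \<Rightarrow> (real \<Rightarrow> real) \<Rightarrow> real \<Rightarrow> ennreal" where
  "frac_max_plus \<alpha> f x =
     (SUP h \<in> {0<..}. ennreal (1 / h powr (1 - \<alpha>)) * (\<integral>\<^sup>+t\<in>{x..x+h}. ennreal \<bar>f t\<bar> \<partial>lebesgue))"

definition frac_max_minus :: "real \<Rightarrow> (real \<Rightarrow> real) \<Rightarrow> real \<Rightarrow> ennreal" where
  "frac_max_minus \<alpha> f x =
     (SUP h \<in> {0<..}. ennreal (1 / h powr (1 - \<alpha>)) * (\<integral>\<^sup>+t\<in>{x-h..x}. ennreal \<bar>f t\<bar> \<partial>lebesgue))"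

definition Apq_plus_char :: "real \<Rightarrow> real \<Rightarrow> (real \<Rightarrow> real) \<Rightarrow> ennreal" where
  "Apq_plus_char p q w = (SUP x. SUP h \<in> {0<..}.
     (ennreal (1 / h) * (\<integral>\<^sup>+t\<in>{x-h..x}. ennreal (w t powr q) \<partial>lebesgue)) *
     ennpow (ennreal (1 / h) * (\<integral>\<^sup>+t\<in>{x..x+h}. ennreal (w t powr (- conj_exp p)) \<partial>lebesgue))
       (q / conj_exp p))"

definition Apq_minus_char :: "real \<Rightarrow> real \<Rightarrow> (real \<Rightarrow> real) \<Rightarrow> ennreal" where
  "Apq_minus_char p q w = (SUP x. SUP h \<in> {0<..}.
     (ennreal (1 / h) * (\<integral>\<^sup>+t\<in>{x..x+h}. ennreal (w t powr q) \<partial>lebesgue)) *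
     ennpow (ennreal (1 / h) * (\<integral>\<^sup>+t\<in>{x-h..x}. ennreal (w t powr (- conj_exp p)) \<partial>lebesgue))
       (q / conj_exp p))"

definition Apq_plus :: "real \<Rightarrow> real \<Rightarrow> (real \<Rightarrow> real) set" where
  "Apq_plus p q = {w. weight w \<and> Apq_plus_char p q w < \<infinity>}"

definition Apq_minus :: "real \<Rightarrow> real \<Rightarrow> (real \<Rightarrow> real) set" where
  "Apq_minus p q = {w. weight w \<and> Apq_minus_char p q w < \<infinity>}"

end

(* Write mu = w^q dx, tau = w^{-p'} dx, m = q/p', beta = 1 - alpha. If M_alpha^+ f(x) > lambda, a
   point b maximizing the difference of the integral of |f| over (x,b] and lambda (b-x)^beta has the
   property that |f| still has integral at least c lambda (b-x)^beta over (y,b] for every y in the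
   left half of (x,b]. Hoelder's inequality bounds this integral by tau(y,b]^m Q(y), up to powers,
   where Q is a power of the one-sided maximal function of f w^{p'} with respect to tau. Integrating
   in y, and using that tau(y,b]^m decreases in y while the A_{p,q}^+ condition controls its
   mu-integral over (x,b], bounds M_alpha^+ f(x)^{m/beta} by the characteristic times the one-sided
   maximal function of Q w^{-q} with respect to mu. One-sided maximal functions with respect to
   an atomless locally finite measure are bounded on L^r with a constant depending on r only, so
   two applications give the sharp power of the characteristic. Power weights |x|^{(1-d)/p'} with
   d -> 0 show that the power is optimal, and reflection x -> -x gives the statement on M_alpha^-. *)
theory Submission
  imports Defs "HOL-Real_Asymp.Real_Asymp"
begin

subsection \<open>Real powers on the extended half-line\<close>

text \<open>The exponent is sharp because the characteristic is spent only once: all other estimates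
  are maximal inequalities whose constants do not see the measure, since on one side of the line
  disjoint rising-sun blocks take the place of covering arguments. The obstacle is that the
  \<open>A_{p,q}^+\<close> condition compares adjacent intervals, whereas averaging over
  \<open>y\<close> pairs \<open>mu\<close> near \<open>y\<close> with \<open>tau\<close> on an
  interval starting at \<open>y\<close>. Cutting \<open>(x,b]\<close> where the remaining
  \<open>tau\<close>-mass halves restores adjacency. The powers are forced. The power
  \<open>m/beta\<close> of the integral of \<open>|f|\<close> over \<open>(y,b]\<close> is factored:
  a share \<open>(p-1)/beta\<close> goes to the \<open>tau\<close>-average of
  \<open>f w^{p'}\<close>, the rest to Hoelder's inequality with norm at most 1. The
  \<open>tau\<close>-masses then combine to the power \<open>m\<close> of the condition, and the
  length \<open>b-x\<close> occurs to the power \<open>m+1\<close> on both sides. The outer maximal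
  function lives in \<open>L^s(mu)\<close> with \<open>s = p'(1-alpha)\<close>: then
  \<open>(m/beta)s = q\<close>, \<open>((p-1)/beta)s = p\<close> and
  \<open>w^{q(1-s)} = w^{-p'}\<close>, so its norm becomes one in \<open>L^p(tau)\<close>, and the
  characteristic comes out to the power \<open>s/q\<close>.\<close>

lemma ennpow_ennreal: "0 \<le> x \<Longrightarrow> ennpow (ennreal x) r = ennreal (x powr r)"
  by (simp add: ennpow_def)

lemma ennpow_top [simp]: "ennpow \<infinity> r = \<infinity>" "ennpow top r = top"
  by (simp_all add: ennpow_def)

lemma ennpow_0 [simp]: "ennpow 0 r = 0"
  by (simp add: ennpow_def)

lemma ennpow_1 [simp]: "ennpow 1 r = 1"
  by (simp add: ennpow_def)

lemma ennpow_exp_1 [simp]: "ennpow x 1 = x"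
  by (cases x) (simp_all add: ennpow_def)

lemma ennpow_mono: "x \<le> y \<Longrightarrow> 0 \<le> r \<Longrightarrow> ennpow x r \<le> ennpow y r"
  by (cases x; cases y) (auto simp: ennpow_ennreal intro!: ennreal_leI powr_mono2 simp: top_unique)

lemma ennpow_eq_0_iff: "ennpow x r = 0 \<longleftrightarrow> x = 0"
  by (cases x) (auto simp: ennpow_def)

text \<open>Powers fix both \<open>0\<close> and \<open>top\<close>, so the convention
  \<open>0 * top = 0\<close> is respected on both sides.\<close>

lemma ennpow_mult: "ennpow (x * y) r = ennpow x r * ennpow y r"
proof -
  consider a b where "x = ennreal a" "y = ennreal b" "0 \<le> a" "0 \<le> b"
    | "x = top" | "y = top" by (cases x; cases y) auto
  then show ?thesis
  proof cases
    case 1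
    then show ?thesis
      by (simp add: ennpow_ennreal powr_mult flip: ennreal_mult)
  next
    case 2
    then show ?thesis
      by (cases "y = 0") (simp_all add: ennreal_top_mult ennpow_eq_0_iff)
  next
    case 3
    then show ?thesis
      by (cases "x = 0") (simp_all add: ennreal_mult_top ennpow_eq_0_iff)
  qed
qed

lemma ennpow_add: "ennpow x (r + s) = ennpow x r * ennpow x s"
  by (cases x) (simp_all add: ennpow_ennreal powr_add ennreal_top_mult flip: ennreal_mult)

lemma ennpow_ennpow: "ennpow (ennpow x r) s = ennpow x (r * s)"
  by (cases x) (simp_all add: ennpow_ennreal powr_powr)

lemma borel_measurable_ennpow [measurable (raw)]:
  assumes "f \<in> borel_measurable M"
  shows "(\<lambda>x. ennpow (f x) r) \<in> borel_measurable M"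
  using assms unfolding ennpow_def by measurable

lemma ennpow_le_ennpow_iff: "0 < r \<Longrightarrow> ennpow x r \<le> ennpow y r \<longleftrightarrow> x \<le> y"
  using ennpow_mono[of "ennpow x r" "ennpow y r" "1 / r"] ennpow_mono[of x y r]
  by (auto simp: ennpow_ennpow)

text \<open>The fundamental theorem of calculus for \<open>s powr r\<close>, with a divergent
  integral when \<open>x = top\<close>. Combined with Fubini's theorem it turns estimates of level
  sets into norm estimates.\<close>

lemma ennpow_layer_cake:
  assumes r: "0 < r"
  shows "(\<integral>\<^sup>+s. ennreal (r * s powr (r - 1)) * indicator {s. 0 < s \<and> ennreal s < x} s \<partial>lborel)
         = ennpow x r"
proof -
  have fin: "(\<integral>\<^sup>+s. ennreal (r * s powr (r - 1)) * indicator {0..c} s \<partial>lborel) = ennreal (c powr r)"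
    if c: "0 \<le> c" for c
  proof -
    have "((\<lambda>s. r * s powr (r - 1)) has_integral r * (c powr ((r - 1) + 1) / ((r - 1) + 1))) {0..c}"
      using r c by (intro has_integral_mult_right has_integral_powr_from_0) auto
    then have "((\<lambda>s. r * s powr (r - 1)) has_integral (c powr r)) {0..c}"
      using r by simp
    then show ?thesis
      using r by (intro nn_integral_has_integral_lebesgue') auto
  qed
  have fin': "(\<integral>\<^sup>+s. ennreal (r * s powr (r - 1)) * indicator {s. 0 < s \<and> ennreal s < ennreal c} s \<partial>lborel)
       = ennreal (c powr r)" if c: "0 \<le> c" for c
  proof -
    have "AE s in lborel. s \<noteq> 0 \<and> s \<noteq> (c::real)"
      using AE_lborel_singleton[of 0] AE_lborel_singleton[of c] by eventually_elim auto
    then have "(\<integral>\<^sup>+s. ennreal (r * s powr (r - 1)) * indicator {s. 0 < s \<and> ennreal s < ennreal c} s \<partial>lborel)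
        = (\<integral>\<^sup>+s. ennreal (r * s powr (r - 1)) * indicator {0..c} s \<partial>lborel)"
      by (intro nn_integral_cong_AE, elim eventually_mono) (use c in \<open>auto split: split_indicator simp: ennreal_less_iff\<close>)
    then show ?thesis
      using fin[OF c] by simp
  qed
  show ?thesis
  proof (cases x)
    case (real c)
    then show ?thesis
      using fin'[of c] by (simp add: ennpow_ennreal)
  next
    case top
    let ?I = "\<integral>\<^sup>+s. ennreal (r * s powr (r - 1)) * indicator {s. 0 < s \<and> ennreal s < top} s \<partial>lborel"
    \<comment> \<open>Truncation at \<open>c powr (1 / r)\<close> gives the value \<open>c\<close>,
      so the integral exceeds every real.\<close>
    have le: "ennreal c \<le> ?I" if "0 \<le> c" for c
    proof -
      have "ennreal c = ennreal ((c powr (1 / r)) powr r)"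
        using that r by (simp add: powr_powr)
      also have "\<dots> = (\<integral>\<^sup>+s. ennreal (r * s powr (r - 1))
            * indicator {s. 0 < s \<and> ennreal s < ennreal (c powr (1 / r))} s \<partial>lborel)"
        by (rule fin'[symmetric]) simp
      also have "\<dots> \<le> ?I"
        by (intro nn_integral_mono mult_left_mono) (auto split: split_indicator)
      finally show ?thesis .
    qed
    have "(SUP n. of_nat n) \<le> ?I"
      using le[of "real n" for n] by (intro SUP_least) (simp add: ennreal_of_nat_eq_real_of_nat)
    then have "?I = top"
      by (simp only: ennreal_SUP_of_nat_eq_top top_unique)
    then show ?thesis
      using top by simp
  qed
qed

subsection \<open>One-sided maximal functions for atomless measures\<close>

text \<open>A discrete rising sun lemma: the indices from which some later partial sum is positive
  decompose into blocks with positive sum.\<close>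

lemma sum_rising_nonneg:
  fixes c :: "nat \<Rightarrow> real"
  defines "E \<equiv> \<lambda>N. {i. i < N \<and> (\<exists>j. i < j \<and> j \<le> N \<and> 0 < sum c {i..<j})}"
  shows "0 \<le> sum c (E N)"
proof -
  \<comment> \<open>Generalized to tails: a tail either drops its first index or splits into one
    block and a shorter tail.\<close>
  have "0 \<le> sum c (E N \<inter> {a..<N})" for a
  proof (induction "N - a" arbitrary: a rule: less_induct)
    case less
    show ?case
    proof (cases "a < N")
      case False
      then show ?thesis by simp
    next
      case aN: True
      show ?thesis
      proof (cases "a \<in> E N")
        case False
        have "E N \<inter> {a..<N} = E N \<inter> {Suc a..<N}"
        proof (intro equalityI subsetI)
          fix i assume "i \<in> E N \<inter> {a..<N}"
          moreover from this have "i \<noteq> a" using False by blast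
          ultimately show "i \<in> E N \<inter> {Suc a..<N}" by simp
        qed simp
        with less[of "Suc a"] aN show ?thesis by simp
      next
        case True
        \<comment> \<open>Minimality makes the proper initial sums of \<open>{a..<j}\<close>
          nonpositive. Hence all its final sums are positive, and the whole block lies in
          \<open>E N\<close>.\<close>
        define j where "j = (LEAST j. a < j \<and> j \<le> N \<and> 0 < sum c {a..<j})"
        have j: "a < j \<and> j \<le> N \<and> 0 < sum c {a..<j}"
          unfolding j_def using True by (rule_tac LeastI_ex) (auto simp: E_def)
        have sub: "i \<in> E N" if "a \<le> i" "i < j" for i
        proof -
          have "sum c {a..<i} \<le> 0"
          proof (cases "i = a")
            case False
            have "\<not> (a < i \<and> i \<le> N \<and> 0 < sum c {a..<i})"
              using not_less_Least[of i] that unfolding j_def by blast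
            then show ?thesis using that j False by auto
          qed simp
          moreover have "sum c {a..<j} = sum c {a..<i} + sum c {i..<j}"
            using that by (simp add: sum.atLeastLessThan_concat)
          ultimately have "0 < sum c {i..<j}" using j by linarith
          then show ?thesis using j that unfolding E_def by auto
        qed
        have "E N \<inter> {a..<N} = {a..<j} \<union> (E N \<inter> {j..<N})"
          using sub j by auto
        moreover have "sum c ({a..<j} \<union> (E N \<inter> {j..<N})) = sum c {a..<j} + sum c (E N \<inter> {j..<N})"
          by (intro sum.union_disjoint) auto
        moreover have "0 \<le> sum c (E N \<inter> {j..<N})"
          using aN j by (intro less.hyps) linarith
        ultimately show ?thesis using j by simp
      qed
    qed
  qed
  moreover have "E N \<inter> {0..<N} = E N" by (auto simp: E_def)
  ultimately show ?thesis by metis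
qed

text \<open>Rational end points make the supremum countable, hence measurable. For \<open>t \<le> x\<close> the quotient is
  \<open>0 / 0 = 0\<close>, so \<open>t\<close> need not be restricted.\<close>

definition max_rat :: "real measure \<Rightarrow> (real \<Rightarrow> ennreal) \<Rightarrow> real \<Rightarrow> ennreal" where
  "max_rat M \<phi> x = (SUP t\<in>\<rat>. (\<integral>\<^sup>+y\<in>{x<..t}. \<phi> y \<partial>M) / emeasure M {x<..t})"

text \<open>The sigma-algebra is that of the Lebesgue sets, so that densities of Lebesgue measurable
  weights qualify. Absence of atoms makes end points irrelevant and the mass of an interval
  continuous in its ends. Constants derived from these axioms alone cannot depend on a
  weight.\<close>

locale diffuse_measure =
  fixes M :: "real measure"
  assumes sets_M [measurable_cong]: "sets M = sets lebesgue"
    and finite_Icc: "\<And>a b. emeasure M {a..b} < \<infinity>"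
    and no_atoms: "\<And>x. emeasure M {x} = 0"
begin

section \<open>Mass of intervals: finiteness, additivity, continuity\<close>

lemma space_M [simp]: "space M = UNIV"
  using sets_eq_imp_space_eq[OF sets_M] by simp

lemma sets_M_borel: "A \<in> sets borel \<Longrightarrow> A \<in> sets M"
  using sets_M by auto

lemma sets_M_borel_real [simp, measurable]: "{a<..b} \<in> sets M" "{a..b} \<in> sets M" "{a<..<b} \<in> sets M" "{a..<b} \<in> sets M"
  by (intro sets_M_borel; simp)+

lemma measurable_ident_borel [measurable]: "(\<lambda>x. x) \<in> measurable M borel"
  by (rule measurableI) (auto intro: sets_M_borel)

lemma borel_measurable_M: "f \<in> borel_measurable borel \<Longrightarrow> f \<in> borel_measurable M"
  by (rule measurable_compose[OF measurable_ident_borel])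

lemma finite_Ioc [simp]: "emeasure M {a<..b} \<noteq> \<infinity>" "emeasure M {a<..b} \<noteq> top" "emeasure M {a<..b} < top"
proof -
  have "emeasure M {a<..b} \<le> emeasure M {a..b}"
    by (intro emeasure_mono) auto
  then show "emeasure M {a<..b} \<noteq> \<infinity>" "emeasure M {a<..b} \<noteq> top" "emeasure M {a<..b} < top"
    using finite_Icc[of a b] by (auto simp: less_top top_unique)
qed

lemma emeasure_Ioc: "emeasure M {a<..b} = ennreal (measure M {a<..b})"
  by (simp add: emeasure_eq_ennreal_measure)

lemma measure_Ioc_split: "a \<le> b \<Longrightarrow> b \<le> c \<Longrightarrow> measure M {a<..c} = measure M {a<..b} + measure M {b<..c}"
proof -
  assume "a \<le> b" "b \<le> c"
  then have "{a<..c} = {a<..b} \<union> {b<..c}" "{a<..b} \<inter> {b<..c} = {}" by auto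
  then show ?thesis
    by (simp add: measure_Union)
qed

lemma measure_Ioc_mono: "a' \<le> a \<Longrightarrow> b \<le> b' \<Longrightarrow> measure M {a<..b} \<le> measure M {a'<..b'}"
  by (rule measure_mono_fmeasurable) (auto simp: fmeasurable_def)

lemma sigma_finite: "sigma_finite_measure M"
proof
  have "\<exists>n::nat. x \<in> {- real n..real n}" for x
    using real_arch_simple[of "\<bar>x\<bar>"] by (auto simp: abs_le_iff minus_le_iff)
  then have "(\<Union>n::nat. {- real n..real n}) = UNIV" by blast
  then show "\<exists>A. countable A \<and> A \<subseteq> sets M \<and> \<Union> A = space M \<and> (\<forall>a\<in>A. emeasure M a \<noteq> \<infinity>)"
    using finite_Icc by (intro exI[of _ "range (\<lambda>n::nat. {- real n..real n})"]) (auto simp: less_top)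
qed

lemma emeasure_Icc: "a \<le> b \<Longrightarrow> emeasure M {a..b} = emeasure M {a<..b}"
proof -
  assume "a \<le> b"
  then have "{a..b} = {a} \<union> {a<..b}" by auto
  moreover have "{a} \<inter> {a<..b} = {}" by auto
  moreover have "{a} \<in> sets M" by (intro sets_M_borel) simp
  ultimately show ?thesis
    using plus_emeasure[of "{a}" M "{a<..b}"] by (simp add: no_atoms)
qed

text \<open>Continuity from above; the limit interval contains its left end point, which is no atom.
  This gives the room for rounding to a grid in \<open>max_rat_weak_type\<close>.\<close>

lemma small_enlargement:
  assumes "x \<le> t" "0 < e"
  obtains d where "0 < d" "measure M {x - d<..t + d} < measure M {x<..t} + e"
proof -
  define A where "A = (\<lambda>n::nat. {x - 1 / Suc n<..t + 1 / Suc n})"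
  have "(\<Inter>n. A n) = {x..t}"
  proof (intro equalityI subsetI)
    fix y assume y: "y \<in> (\<Inter>n. A n)"
    have "x \<le> y"
    proof (rule ccontr)
      assume "\<not> x \<le> y"
      then obtain n where "inverse (real (Suc n)) < x - y"
        using reals_Archimedean[of "x - y"] by auto
      then show False using y by (auto simp: A_def field_simps dest!: spec[of _ n])
    qed
    moreover have "y \<le> t"
    proof (rule ccontr)
      assume "\<not> y \<le> t"
      then obtain n where "inverse (real (Suc n)) < y - t"
        using reals_Archimedean[of "y - t"] by auto
      then show False using y by (auto simp: A_def field_simps dest!: spec[of _ n])
    qed
    ultimately show "y \<in> {x..t}" by simp
  next
    fix y assume "y \<in> {x..t}"
    then show "y \<in> (\<Inter>n. A n)"
      by (auto simp: A_def intro: order.strict_trans2[of _ x] order_trans[of _ t])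
  qed
  moreover have "(\<lambda>n. emeasure M (A n)) \<longlonglongrightarrow> emeasure M (\<Inter>n. A n)"
  proof (rule Lim_emeasure_decseq)
    show "decseq A"
      unfolding A_def
    proof (rule decseq_SucI)
      fix n :: nat
      have "1 / real (Suc (Suc n)) \<le> 1 / real (Suc n)" by (intro frac_le) auto
      then show "{x - 1 / real (Suc (Suc n))<..t + 1 / real (Suc (Suc n))}
          \<subseteq> {x - 1 / real (Suc n)<..t + 1 / real (Suc n)}"
        by (auto simp del: of_nat_Suc)
    qed
  qed (auto simp: A_def)
  ultimately have "(\<lambda>n. emeasure M (A n)) \<longlonglongrightarrow> emeasure M {x<..t}"
    using assms by (simp add: emeasure_Icc)
  then have "(\<lambda>n. measure M (A n)) \<longlonglongrightarrow> measure M {x<..t}"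
    unfolding A_def emeasure_Ioc by (simp add: tendsto_ennreal_iff)
  then have "eventually (\<lambda>n. measure M (A n) < measure M {x<..t} + e) sequentially"
    using assms by (intro order_tendstoD(2)) auto
  then obtain n where "measure M (A n) < measure M {x<..t} + e"
    by (auto simp: eventually_sequentially)
  then show ?thesis
    using that[of "1 / Suc n"] by (simp add: A_def)
qed

text \<open>Moving an end point changes the mass by at most the mass swept over, which is small by
  \<open>small_enlargement\<close> for a degenerate interval.\<close>

lemma continuous_measure_Ioc: "continuous_on UNIV (\<lambda>t. measure M {a<..t})"
  "continuous_on UNIV (\<lambda>t. measure M {t<..b})"
proof -
  have D: "\<exists>d>0. \<forall>s. \<bar>s - t\<bar> < d \<longrightarrow> measure M {min s t<..max s t} < e" if e: "0 < e" for t e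
  proof -
    obtain d where d: "0 < d" "measure M {t - d<..t + d} < measure M {t<..t} + e"
      by (rule small_enlargement[of t t e]) (use e in auto)
    have "measure M {min s t<..max s t} < e" if "\<bar>s - t\<bar> < d" for s
    proof -
      have "t - d \<le> min s t" "max s t \<le> t + d" using that d by auto
      from measure_Ioc_mono[OF this] show ?thesis using d by simp
    qed
    then show ?thesis using d by blast
  qed
  have 1: "\<bar>measure M {a<..s} - measure M {a<..t}\<bar> \<le> measure M {min s t<..max s t}" for s t
  proof (induction s t rule: linorder_wlog)
    case (le s t)
    show ?case
    proof (cases "a \<le> s")
      case True then show ?thesis using measure_Ioc_split[of a s t] le by simp
    next
      case False then show ?thesis using le measure_Ioc_mono[of s a t t] by simp
    qed
  qed (simp add: abs_minus_commute min.commute max.commute)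
  have 2: "\<bar>measure M {s<..b} - measure M {t<..b}\<bar> \<le> measure M {min s t<..max s t}" for s t
  proof (induction s t rule: linorder_wlog)
    case (le s t)
    show ?case
    proof (cases "t \<le> b")
      case True then show ?thesis using measure_Ioc_split[of s t b] le by simp
    next
      case False then show ?thesis using le measure_Ioc_mono[of s s b t] by simp
    qed
  qed (simp add: abs_minus_commute min.commute max.commute)
  show "continuous_on UNIV (\<lambda>t. measure M {a<..t})"
    unfolding continuous_on_iff dist_real_def 
    using D by (meson 1 order.strict_trans1)
  show "continuous_on UNIV (\<lambda>t. measure M {t<..b})"
    unfolding continuous_on_iff dist_real_def 
    using D by (meson 2 order.strict_trans1)
qed

lemma max_rat_measurable [measurable]:
  assumes [measurable]: "\<phi> \<in> borel_measurable M"
  shows "max_rat M \<phi> \<in> borel_measurable M"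
proof -
  interpret sigma_finite_measure M by (rule sigma_finite)
  \<comment> \<open>Written as a conditional, the indicator is jointly measurable in
    \<open>x\<close> and \<open>y\<close>, so the integral over \<open>y\<close> is measurable in
    \<open>x\<close>.\<close>
  have eq: "indicator {x<..t} y = (if x < y \<and> y \<le> t then 1 else 0 :: ennreal)" for x y t :: real
    by (auto simp: indicator_def)
  have m: "(\<lambda>x. \<integral>\<^sup>+y\<in>{x<..t}. f y \<partial>M) \<in> borel_measurable M"
    if [measurable]: "f \<in> borel_measurable M" for f and t
  proof (rule borel_measurable_nn_integral)
    show "(\<lambda>(x, y). f y * indicator {x<..t} y) \<in> borel_measurable (M \<Otimes>\<^sub>M M)"
      unfolding eq split_beta by measurable
  qed
  have 1: "(\<lambda>x. emeasure M {x<..t}) \<in> borel_measurable M" for t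
    using m[of "\<lambda>_. 1" t] by simp
  show ?thesis
    unfolding max_rat_def using m[OF assms] 1
    by (intro borel_measurable_SUP countable_rat borel_measurable_divide_ennreal) auto
qed

lemma diffuse_density:
  assumes [measurable]: "g \<in> borel_measurable M"
    and "\<And>a b. (\<integral>\<^sup>+y\<in>{a..b}. g y \<partial>M) < \<infinity>"
  shows "diffuse_measure (density M g)"
proof
  show "sets (density M g) = sets lebesgue"
    by (simp add: sets_M)
  show "emeasure (density M g) {a..b} < \<infinity>" for a b
    using assms(2) by (simp add: emeasure_density)
  have "{x} \<in> null_sets M" for x
    using no_atoms[of x] by (intro null_setsI sets_M_borel) auto
  then have "{x} \<in> null_sets (density M g)" for x
    using absolutely_continuousI_density[OF assms(1)] by (auto simp: absolutely_continuous_def)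
  then show "emeasure (density M g) {x} = 0" for x
    by auto
qed

text \<open>Rising sun argument: the selected grid cells are disjoint and together carry at least
  \<open>l\<close> times their \<open>M\<close>-mass in \<open>\<phi>\<close>-mass, so the constant
  is 1 whatever \<open>M\<close> is. The grid reduces the component intervals of an open set to
  finite sums.\<close>

lemma max_rat_weak_type:
  assumes \<phi> [measurable]: "\<phi> \<in> borel_measurable M" and l: "0 < l"
  shows "ennreal l * emeasure M {x. ennreal l < max_rat M \<phi> x} \<le> (\<integral>\<^sup>+y. \<phi> y \<partial>M)"
proof (cases "(\<integral>\<^sup>+y. \<phi> y \<partial>M) = \<infinity>")
  case True
  then show ?thesis by simp
next
  case fin: False
  define N where "N = density M \<phi>"
  interpret N: diffuse_measure N
    unfolding N_def
  proof (rule diffuse_density)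
    show "(\<integral>\<^sup>+y\<in>{a..b}. \<phi> y \<partial>M) < \<infinity>" for a b
      using fin by (rule_tac order.strict_trans1[OF nn_integral_mono[where v = \<phi>]])
        (auto split: split_indicator simp: less_top)
  qed simp
  have N_UNIV: "emeasure N A \<le> (\<integral>\<^sup>+y. \<phi> y \<partial>M)" if "A \<in> sets M" for A
    unfolding N_def using that
    by (subst emeasure_density) (auto intro!: nn_integral_mono split: split_indicator)
  have fmN: "A \<in> sets M \<Longrightarrow> A \<in> fmeasurable N" for A
    using N_UNIV[of A] fin by (auto simp: fmeasurable_def N_def less_top top_unique)
  \<comment> \<open>Excess of the \<open>\<phi>\<close>-mass over the level \<open>l\<close>. It is
    additive over adjacent intervals, so sums over grid cells telescope.\<close>
  define D where "D = (\<lambda>x t. measure N {x<..t} - l * measure M {x<..t})"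
  have D_split: "D x t = D x z + D z t" if "x \<le> z" "z \<le> t" for x z t
    using measure_Ioc_split[OF that] N.measure_Ioc_split[OF that] by (simp add: D_def algebra_simps)
  \<comment> \<open>The \<open>2 * Suc k ^ 2\<close> cells of length \<open>1 / Suc k\<close> fill
    the interval from \<open>- Suc k\<close> to \<open>Suc k\<close>.\<close>
  define g where "g = (\<lambda>(k::nat) (i::nat). real i / Suc k - Suc k)"
  have g_mono: "i \<le> j \<Longrightarrow> g k i \<le> g k j" for i j k
    by (auto simp: g_def divide_right_mono)
  define J where "J = (\<lambda>k. {i. i < 2 * Suc k ^ 2 \<and>
      (\<exists>j. i < j \<and> j \<le> 2 * Suc k ^ 2 \<and> 0 < (\<Sum>m\<in>{i..<j}. D (g k m) (g k (Suc m))))})"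
  \<comment> \<open>the discrete lemma on a grid of mesh \<open>1 / (k + 1)\<close>; the resulting sets \<open>B k\<close> eventually
    contain every point of the level set, so Fatou's lemma gives the claim\<close>
  define B where "B = (\<lambda>k. \<Union>i\<in>J k. {g k i<..g k (Suc i)})"
  have fJ: "finite (J k)" for k
    unfolding J_def by simp
  have B_sets [measurable]: "B k \<in> sets M" for k
    unfolding B_def using fJ by (intro sets.finite_UN) auto
  have disj: "disjoint_family_on (\<lambda>i. {g k i<..g k (Suc i)}) (J k)" for k
    unfolding disjoint_family_on_def
  proof (intro ballI impI)
    fix i j :: nat assume "i \<noteq> j"
    then show "{g k i<..g k (Suc i)} \<inter> {g k j<..g k (Suc j)} = {}"
      using g_mono[of "Suc i" j k] g_mono[of "Suc j" i k] by (cases i j rule: linorder_cases) auto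
  qed
  have B_le: "ennreal l * emeasure M (B k) \<le> (\<integral>\<^sup>+y. \<phi> y \<partial>M)" for k
  proof -
    have "measure N (B k) - l * measure M (B k) = (\<Sum>i\<in>J k. D (g k i) (g k (Suc i)))"
      unfolding B_def D_def using fJ disj
      by (subst (1 2) measure_finite_Union) (auto simp: sum_subtractf sum_distrib_left)
    also have "0 \<le> \<dots>"
      unfolding J_def by (rule sum_rising_nonneg)
    finally have *: "l * measure M (B k) \<le> measure N (B k)" by simp
    have "emeasure M (B k) < \<infinity>"
      unfolding B_def using fJ by (rule_tac order.strict_trans1[OF emeasure_subadditive_finite]) auto
    then have "ennreal l * emeasure M (B k) = ennreal (l * measure M (B k))"
      using l by (simp add: emeasure_eq_ennreal_measure ennreal_mult)
    also have "\<dots> \<le> ennreal (measure N (B k))"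
      using * by (rule ennreal_leI)
    also have "\<dots> = emeasure N (B k)"
      using fmN[of "B k"] by (simp add: emeasure_eq_measure2)
    also have "\<dots> \<le> (\<integral>\<^sup>+y. \<phi> y \<partial>M)"
      by (rule N_UNIV) simp
    finally show ?thesis .
  qed
  \<comment> \<open>A strict excess on \<open>{x<..t}\<close> survives rounding \<open>x\<close>
    down and \<open>t\<close> up to a fine grid, so the cell containing \<open>x\<close> gets
    selected.\<close>
  have ev: "eventually (\<lambda>k. x \<in> B k) sequentially" if x: "ennreal l < max_rat M \<phi> x" for x
  proof -
    obtain t where t: "ennreal l < (\<integral>\<^sup>+y\<in>{x<..t}. \<phi> y \<partial>M) / emeasure M {x<..t}"
      using x unfolding max_rat_def less_SUP_iff by auto
    have "\<not> (\<integral>\<^sup>+y\<in>{x<..t}. \<phi> y \<partial>M) \<le> emeasure M {x<..t} * ennreal l"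
    proof
      assume le: "(\<integral>\<^sup>+y\<in>{x<..t}. \<phi> y \<partial>M) \<le> emeasure M {x<..t} * ennreal l"
      show False
      proof (cases "emeasure M {x<..t} = 0")
        case True
        then show False using le t by simp
      next
        case False
        then have "(\<integral>\<^sup>+y\<in>{x<..t}. \<phi> y \<partial>M) / emeasure M {x<..t} \<le> ennreal l"
          using le by (intro divide_le_posI_ennreal) (auto simp: zero_less_iff_neq_zero)
        then show False using t by simp
      qed
    qed
    then have "ennreal (measure M {x<..t} * l) < ennreal (measure N {x<..t})"
      unfolding N.emeasure_Ioc[symmetric] using l
      by (simp add: N_def emeasure_density emeasure_Ioc ennreal_mult not_le)
    then have lt: "measure M {x<..t} * l < measure N {x<..t}"
      using l by (simp add: ennreal_less_iff)
    have xt: "x < t"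
      using lt by (cases "x < t") auto
    \<comment> \<open>The slack in \<open>lt\<close>, divided by \<open>l\<close>, is the growth of
      the \<open>M\<close>-mass that the enlargement may cause.\<close>
    obtain d where d: "0 < d"
      "measure M {x - d<..t + d} < measure M {x<..t} + (measure N {x<..t} / l - measure M {x<..t})"
      by (rule small_enlargement[of x t "measure N {x<..t} / l - measure M {x<..t}"])
        (use l lt xt in \<open>auto simp: field_simps\<close>)
    then have d': "l * measure M {x - d<..t + d} < measure N {x<..t}"
      using l by (simp add: field_simps)
    have "eventually (\<lambda>k. 1 / Suc k < d) sequentially"
      using d by real_asymp
    moreover have "eventually (\<lambda>k. - real (Suc k) < x) sequentially"
      by real_asymp
    moreover have "eventually (\<lambda>k. t < real (Suc k)) sequentially"
      by real_asymp
    ultimately show ?thesis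
    proof eventually_elim
      fix k assume k: "1 / Suc k < d" "- real (Suc k) < x" "t < real (Suc k)"
      define K where "K = real (Suc k)"
      have K: "0 < K" "K * d > 1" "0 < x + K" "t < K"
        using k d by (auto simp: K_def field_simps)
      \<comment> \<open>Ceiling minus one and not the floor: \<open>x\<close> has to lie strictly
        above \<open>g k i\<close>, also when \<open>x\<close> is a grid point.\<close>
      define i where "i = nat (\<lceil>(x + K) * K\<rceil> - 1)"
      define j where "j = nat \<lceil>(t + K) * K\<rceil>"
      have pos: "0 < (x + K) * K" "0 < (t + K) * K" "(x + K) * K < (t + K) * K"
        using K xt by (auto intro!: mult_strict_right_mono)
      have i: "real i < (x + K) * K" "(x + K) * K \<le> real i + 1"
        using pos unfolding i_def by linarith+
      have j: "real j - 1 < (t + K) * K" "(t + K) * K \<le> real j"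
        using pos unfolding j_def by linarith+
      have gi: "g k i < x" "x \<le> g k (Suc i)" "x - d < g k i"
        using i K unfolding g_def K_def[symmetric] by (auto simp: field_simps)
      have gj: "t \<le> g k j" "g k j < t + d"
        using j K unfolding g_def K_def[symmetric] by (auto simp: field_simps)
      have ij: "i < j"
        using gi gj xt g_mono[of j i k] by (cases "i < j") auto
      have "real j < (t + K) * K + 1" using j by simp
      also have "(t + K) * K \<le> (2 * K) * K"
        using K by (intro mult_right_mono) auto
      finally have "real j < real (2 * Suc k ^ 2) + 1"
        by (simp add: K_def power2_eq_square algebra_simps)
      then have jN: "j \<le> 2 * Suc k ^ 2" by linarith
      have tele: "(\<Sum>m\<in>{i..<n}. D (g k m) (g k (Suc m))) = D (g k i) (g k n)" if "i \<le> n" for n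
        using that
      proof (induction n rule: dec_induct)
        case base
        then show ?case by (simp add: D_def)
      next
        case (step n)
        then show ?case
          using D_split[of "g k i" "g k n" "g k (Suc n)"] g_mono by simp
      qed
      have "l * measure M {g k i<..g k j} \<le> l * measure M {x - d<..t + d}"
        using l gi gj by (intro mult_left_mono measure_Ioc_mono) auto
      also have "\<dots> < measure N {x<..t}" by (rule d')
      also have "\<dots> \<le> measure N {g k i<..g k j}"
        using gi gj by (intro N.measure_Ioc_mono) auto
      finally have "0 < D (g k i) (g k j)" by (simp add: D_def)
      then have "i \<in> J k"
        unfolding J_def using ij jN tele[of j] by (auto intro!: exI[of _ j])
      then show "x \<in> B k" using gi unfolding B_def by auto
    qed
  qed
  define A where "A = {x \<in> space M. ennreal l < max_rat M \<phi> x}"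
  have [measurable]: "A \<in> sets M"
    unfolding A_def by measurable
  have A: "{x. ennreal l < max_rat M \<phi> x} = A"
    unfolding A_def space_M by blast
  have "emeasure M A = (\<integral>\<^sup>+x. indicator A x \<partial>M)"
    by (rule nn_integral_indicator[symmetric]) measurable
  also have "\<dots> \<le> (\<integral>\<^sup>+x. liminf (\<lambda>k. indicator (B k) x) \<partial>M)"
  proof (rule nn_integral_mono)
    fix x
    show "indicator A x \<le> liminf (\<lambda>k. indicator (B k) x :: ennreal)"
    proof (cases "x \<in> A")
      case True
      then have "eventually (\<lambda>k. 1 \<le> (indicator (B k) x :: ennreal)) sequentially"
        using ev[of x] unfolding A[symmetric] by (auto elim!: eventually_mono)
      then show ?thesis
        using True by (simp add: Liminf_bounded)
    qed simp
  qed
  also have "\<dots> \<le> liminf (\<lambda>k. \<integral>\<^sup>+x. indicator (B k) x \<partial>M)"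
    by (rule nn_integral_liminf) simp
  also have "\<dots> \<le> (\<integral>\<^sup>+y. \<phi> y \<partial>M) / ennreal l"
  proof -
    have "emeasure M (B k) \<le> (\<integral>\<^sup>+y. \<phi> y \<partial>M) / ennreal l" for k
      using B_le[of k] l divide_less_ennreal[of "ennreal l" "\<integral>\<^sup>+y. \<phi> y \<partial>M" "emeasure M (B k)"]
      by (auto simp: mult.commute simp flip: not_less)
    then show ?thesis
      by (intro order_trans[OF Liminf_le_Limsup] Limsup_bounded) auto
  qed
  finally have "emeasure M A \<le> (\<integral>\<^sup>+y. \<phi> y \<partial>M) / ennreal l" .
  then have "ennreal l * emeasure M A \<le> ennreal l * ((\<integral>\<^sup>+y. \<phi> y \<partial>M) / ennreal l)"
    by (rule mult_left_mono) simp
  also have "\<dots> = (\<integral>\<^sup>+y. \<phi> y \<partial>M)"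
    unfolding ennreal_times_divide mult.commute[of "ennreal l"]
    using l by (intro ennreal_mult_divide_eq) auto
  finally show ?thesis unfolding A .
qed

text \<open>Marcinkiewicz interpolation between the weak type inequality with constant 1 and the
  trivial bound for bounded functions; hence a constant depending on \<open>r\<close> alone.\<close>

lemma max_rat_strong_type:
  assumes \<phi> [measurable]: "\<phi> \<in> borel_measurable M" and r: "1 < r"
  shows "(\<integral>\<^sup>+x. ennpow (max_rat M \<phi> x) r \<partial>M)
    \<le> ennreal (r * 2 powr r / (r - 1)) * (\<integral>\<^sup>+x. ennpow (\<phi> x) r \<partial>M)"
proof -
  interpret sigma_finite_measure M by (rule sigma_finite)
  interpret pair_sigma_finite M lborel ..
  \<comment> \<open>weak type inequality for the truncation of \<open>\<phi>\<close> at half the level\<close>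
  have dist: "emeasure M {x. ennreal l < max_rat M \<phi> x}
      \<le> ennreal (2 / l) * (\<integral>\<^sup>+x. \<phi> x * indicator {x. ennreal l < 2 * \<phi> x} x \<partial>M)"
    if l: "0 < l" for l
  proof -
    define \<phi>1 where "\<phi>1 = (\<lambda>x. \<phi> x * (if ennreal l < 2 * \<phi> x then 1 else 0))"
    have [measurable]: "\<phi>1 \<in> borel_measurable M"
      unfolding \<phi>1_def by measurable
    have le: "\<phi> x \<le> \<phi>1 x + ennreal (l / 2)" for x
    proof (cases "ennreal l < 2 * \<phi> x")
      case False
      then have "2 * \<phi> x \<le> 2 * ennreal (l / 2)"
        using l by (simp flip: ennreal_mult' ennreal_numeral)
      then have "\<phi> x \<le> ennreal (l / 2)"
        by (cases "\<phi> x") (use l in \<open>auto simp: top_unique ennreal_mult_top simp flip: ennreal_mult' ennreal_numeral\<close>)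
      then show ?thesis by (simp add: add_increasing)
    qed (simp add: \<phi>1_def)
    \<comment> \<open>Averages of the part of \<open>\<phi>\<close> below \<open>l / 2\<close> are
      at most \<open>l / 2\<close>; this is the trivial half of the interpolation.\<close>
    have mx: "max_rat M \<phi> x \<le> max_rat M \<phi>1 x + ennreal (l / 2)" for x
      unfolding max_rat_def
    proof (rule SUP_least)
      fix t :: real assume t: "t \<in> \<rat>"
      have "(\<integral>\<^sup>+y\<in>{x<..t}. \<phi> y \<partial>M)
          \<le> (\<integral>\<^sup>+y. \<phi>1 y * indicator {x<..t} y + ennreal (l / 2) * indicator {x<..t} y \<partial>M)"
        using le by (intro nn_integral_mono) (auto split: split_indicator)
      also have "\<dots> = (\<integral>\<^sup>+y\<in>{x<..t}. \<phi>1 y \<partial>M) + ennreal (l / 2) * emeasure M {x<..t}"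
        by (subst nn_integral_add) (auto simp: nn_integral_cmult_indicator)
      finally have "(\<integral>\<^sup>+y\<in>{x<..t}. \<phi> y \<partial>M) / emeasure M {x<..t}
          \<le> ((\<integral>\<^sup>+y\<in>{x<..t}. \<phi>1 y \<partial>M) + ennreal (l / 2) * emeasure M {x<..t}) / emeasure M {x<..t}"
        by (rule divide_right_mono_ennreal)
      also have "\<dots> = (\<integral>\<^sup>+y\<in>{x<..t}. \<phi>1 y \<partial>M) / emeasure M {x<..t}
          + ennreal (l / 2) * emeasure M {x<..t} / emeasure M {x<..t}"
        by (rule add_divide_distrib_ennreal)
      also have "\<dots> \<le> (SUP t\<in>\<rat>. (\<integral>\<^sup>+y\<in>{x<..t}. \<phi>1 y \<partial>M) / emeasure M {x<..t}) + ennreal (l / 2)"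
      proof (rule add_mono)
        show "ennreal (l / 2) * emeasure M {x<..t} / emeasure M {x<..t} \<le> ennreal (l / 2)"
          by (cases "emeasure M {x<..t} = 0") (auto simp: ennreal_mult_divide_eq)
      qed (use t in \<open>auto intro: SUP_upper\<close>)
      finally show "(\<integral>\<^sup>+y\<in>{x<..t}. \<phi> y \<partial>M) / emeasure M {x<..t} \<le> \<dots>" .
    qed
    have sub: "{x. ennreal l < max_rat M \<phi> x} \<subseteq> {x. ennreal (l / 2) < max_rat M \<phi>1 x}"
    proof safe
      fix x assume "ennreal l < max_rat M \<phi> x"
      also note mx[of x]
      finally have "ennreal (l / 2) + ennreal (l / 2) < max_rat M \<phi>1 x + ennreal (l / 2)"
        using l by (simp flip: ennreal_plus)
      then show "ennreal (l / 2) < max_rat M \<phi>1 x"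
        by (meson add_right_mono not_le)
    qed
    have S: "{x \<in> space M. ennreal (l / 2) < max_rat M \<phi>1 x} \<in> sets M"
      by measurable
    have "ennreal (l / 2) * emeasure M {x. ennreal l < max_rat M \<phi> x}
        \<le> ennreal (l / 2) * emeasure M {x. ennreal (l / 2) < max_rat M \<phi>1 x}"
      using sub S by (intro mult_left_mono emeasure_mono) auto
    also have "\<dots> \<le> (\<integral>\<^sup>+x. \<phi>1 x \<partial>M)"
      using l by (intro max_rat_weak_type) auto
    also have "\<dots> = (\<integral>\<^sup>+x. \<phi> x * indicator {x. ennreal l < 2 * \<phi> x} x \<partial>M)"
      by (intro nn_integral_cong) (auto simp: \<phi>1_def)
    finally have "ennreal (2 / l) * (ennreal (l / 2) * emeasure M {x. ennreal l < max_rat M \<phi> x})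
        \<le> ennreal (2 / l) * (\<integral>\<^sup>+x. \<phi> x * indicator {x. ennreal l < 2 * \<phi> x} x \<partial>M)"
      by (rule mult_left_mono) simp
    moreover have "ennreal (2 / l) * ennreal (l / 2) = 1"
      using l by (simp flip: ennreal_mult)
    ultimately show ?thesis
      by (simp flip: mult.assoc)
  qed
  have ind: "indicator {l. 0 < l \<and> ennreal l < X} l = (if 0 < l \<and> ennreal l < X then 1 else 0 :: ennreal)"
    for l X by auto
  have "(\<integral>\<^sup>+x. ennpow (max_rat M \<phi> x) r \<partial>M)
      = (\<integral>\<^sup>+x. (\<integral>\<^sup>+l. ennreal (r * l powr (r - 1)) * (if 0 < l \<and> ennreal l < max_rat M \<phi> x then 1 else 0) \<partial>lborel) \<partial>M)"
    unfolding ind[symmetric] using r by (subst ennpow_layer_cake) auto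
  also have "\<dots> = (\<integral>\<^sup>+l. (\<integral>\<^sup>+x. ennreal (r * l powr (r - 1)) * (if 0 < l \<and> ennreal l < max_rat M \<phi> x then 1 else 0) \<partial>M) \<partial>lborel)"
    by (rule Fubini'[symmetric]) measurable
  also have "\<dots> \<le> (\<integral>\<^sup>+l. (\<integral>\<^sup>+x. ennreal (2 * r * l powr (r - 2)) * (\<phi> x * (if 0 < l \<and> ennreal l < 2 * \<phi> x then 1 else 0)) \<partial>M) \<partial>lborel)"
  proof (rule nn_integral_mono)
    fix l :: real
    show "(\<integral>\<^sup>+x. ennreal (r * l powr (r - 1)) * (if 0 < l \<and> ennreal l < max_rat M \<phi> x then 1 else 0) \<partial>M)
      \<le> (\<integral>\<^sup>+x. ennreal (2 * r * l powr (r - 2)) * (\<phi> x * (if 0 < l \<and> ennreal l < 2 * \<phi> x then 1 else 0)) \<partial>M)"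
    proof (cases "0 < l")
      case l: True
      have S: "{x \<in> space M. ennreal l < max_rat M \<phi> x} \<in> sets M"
        by measurable
      have "(\<integral>\<^sup>+x. ennreal (r * l powr (r - 1)) * (if 0 < l \<and> ennreal l < max_rat M \<phi> x then 1 else 0) \<partial>M)
        = (\<integral>\<^sup>+x. ennreal (r * l powr (r - 1)) * indicator {x \<in> space M. ennreal l < max_rat M \<phi> x} x \<partial>M)"
        using l by (intro nn_integral_cong) auto
      also have "\<dots> = ennreal (r * l powr (r - 1)) * emeasure M {x \<in> space M. ennreal l < max_rat M \<phi> x}"
        using S by (rule nn_integral_cmult_indicator)
      also have "\<dots> \<le> ennreal (r * l powr (r - 1)) * (ennreal (2 / l) * (\<integral>\<^sup>+x. \<phi> x * indicator {x. ennreal l < 2 * \<phi> x} x \<partial>M))"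
        using dist[OF l] by (intro mult_left_mono) auto
      also have "\<dots> = ennreal (2 * r * l powr (r - 2)) * (\<integral>\<^sup>+x. \<phi> x * indicator {x. ennreal l < 2 * \<phi> x} x \<partial>M)"
      proof -
        have "l powr (r - 1) = l powr (r - 2) * l"
          using l by (simp flip: powr_add add: powr_mult_base mult.commute)
        then have "r * l powr (r - 1) * (2 / l) = 2 * r * l powr (r - 2)"
          using l by simp
        then show ?thesis
          using l r by (simp flip: mult.assoc ennreal_mult)
      qed
      also have "\<dots> = (\<integral>\<^sup>+x. ennreal (2 * r * l powr (r - 2)) * (\<phi> x * (if 0 < l \<and> ennreal l < 2 * \<phi> x then 1 else 0)) \<partial>M)"
        using l by (subst nn_integral_cmult[symmetric]) (auto intro!: nn_integral_cong simp: indicator_def)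
      finally show ?thesis .
    qed simp
  qed
  also have "\<dots> = (\<integral>\<^sup>+x. (\<integral>\<^sup>+l. ennreal (2 * r * l powr (r - 2)) * (\<phi> x * (if 0 < l \<and> ennreal l < 2 * \<phi> x then 1 else 0)) \<partial>lborel) \<partial>M)"
    by (rule Fubini') measurable
  also have "\<dots> = (\<integral>\<^sup>+x. ennreal (r * 2 powr r / (r - 1)) * ennpow (\<phi> x) r \<partial>M)"
  proof (rule nn_integral_cong)
    fix x
    \<comment> \<open>Brings the weight into the form of \<open>ennpow_layer_cake\<close> with
      exponent \<open>r - 1\<close>, positive because \<open>1 < r\<close>. The cutoff
      \<open>2 * \<phi> x\<close> contributes \<open>2 powr (r - 1)\<close>, and the free factor
      \<open>\<phi> x\<close> raises the exponent back to \<open>r\<close>.\<close>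
    have c: "ennreal (2 * r * l powr (r - 2)) = ennreal (2 * r / (r - 1)) * ennreal ((r - 1) * l powr (r - 1 - 1))" for l :: real
    proof -
      have "2 * r * l powr (r - 2) = 2 * r / (r - 1) * ((r - 1) * l powr (r - 1 - 1))"
        using r by simp
      also have "ennreal \<dots> = ennreal (2 * r / (r - 1)) * ennreal ((r - 1) * l powr (r - 1 - 1))"
        using r by (intro ennreal_mult) auto
      finally show ?thesis .
    qed
    have "(\<integral>\<^sup>+l. ennreal (2 * r * l powr (r - 2)) * (\<phi> x * (if 0 < l \<and> ennreal l < 2 * \<phi> x then 1 else 0)) \<partial>lborel)
      = (\<integral>\<^sup>+l. ennreal (2 * r / (r - 1)) * \<phi> x * (ennreal ((r - 1) * l powr (r - 1 - 1)) * indicator {l. 0 < l \<and> ennreal l < 2 * \<phi> x} l) \<partial>lborel)"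
      unfolding c by (intro nn_integral_cong) (auto simp: mult_ac)
    also have "\<dots> = ennreal (2 * r / (r - 1)) * \<phi> x * ennpow (2 * \<phi> x) (r - 1)"
      using r ennpow_layer_cake[of "r - 1" "2 * \<phi> x"] unfolding ind
      by (subst nn_integral_cmult) auto
    also have "\<dots> = ennreal (2 * r / (r - 1)) * ennreal (2 powr (r - 1)) * (ennpow (\<phi> x) 1 * ennpow (\<phi> x) (r - 1))"
      using ennpow_ennreal[of 2 "r - 1"] by (simp add: ennpow_mult mult_ac)
    also have "ennpow (\<phi> x) 1 * ennpow (\<phi> x) (r - 1) = ennpow (\<phi> x) r"
      by (subst ennpow_add[symmetric]) simp
    also have "ennreal (2 * r / (r - 1)) * ennreal (2 powr (r - 1)) = ennreal (r * 2 powr r / (r - 1))"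
    proof -
      have "2 * r / (r - 1) * 2 powr (r - 1) = r * 2 powr r / (r - 1)"
      proof -
        have "2 * r / s * (P / 2) = r * P / s" for s P :: real by simp
        then show ?thesis by (metis powr_diff powr_one zero_le_numeral)
      qed
      then show ?thesis
        using r by (subst ennreal_mult[symmetric]) (auto simp only: zero_le_divide_iff powr_ge_zero)
    qed
    finally show "(\<integral>\<^sup>+l. ennreal (2 * r * l powr (r - 2)) * (\<phi> x * (if 0 < l \<and> ennreal l < 2 * \<phi> x then 1 else 0)) \<partial>lborel)
      = ennreal (r * 2 powr r / (r - 1)) * ennpow (\<phi> x) r" .
  qed
  also have "\<dots> = ennreal (r * 2 powr r / (r - 1)) * (\<integral>\<^sup>+x. ennpow (\<phi> x) r \<partial>M)"
    by (rule nn_integral_cmult) measurable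
  finally show ?thesis .
qed

text \<open>Rational end points lose nothing: intervals \<open>{x<..s}\<close> with rational
  \<open>s\<close> tending to \<open>t\<close> exhaust the open interval, and Fatou's lemma passes
  to the limit.\<close>

lemma integral_le_max_rat:
  "(\<integral>\<^sup>+y\<in>{x<..<t}. \<phi> y \<partial>M) \<le> max_rat M \<phi> x * emeasure M {x<..<t}"
  if [measurable]: "\<phi> \<in> borel_measurable M"
proof (cases "x < t")
  case True
  have le: "(\<integral>\<^sup>+y\<in>{x<..s}. \<phi> y \<partial>M) \<le> max_rat M \<phi> x * emeasure M {x<..<t}" if s: "s \<in> \<rat>" "s < t" for s
  proof -
    let ?I = "\<integral>\<^sup>+y\<in>{x<..s}. \<phi> y \<partial>M"
    have *: "?I \<le> max_rat M \<phi> x * emeasure M {x<..s}"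
    \<comment> \<open>A null interval carries no \<open>\<phi>\<close>-mass, so the value of the
      quotient there is harmless.\<close>
    proof (cases "emeasure M {x<..s} = 0")
      case True
      then have "{x<..s} \<in> null_sets M" by (intro null_setsI) auto
      then have "AE y in M. y \<notin> {x<..s}" by (rule AE_not_in)
      then have "?I = (\<integral>\<^sup>+y. 0 \<partial>M)" by (intro nn_integral_cong_AE) (auto elim!: eventually_mono)
      then show ?thesis by simp
    next
      case False
      have "?I = ?I / emeasure M {x<..s} * emeasure M {x<..s}"
        using False by (simp add: ennreal_divide_times ennreal_mult_divide_eq)
      also have "\<dots> \<le> max_rat M \<phi> x * emeasure M {x<..s}"
        unfolding max_rat_def using s by (intro mult_right_mono SUP_upper) auto
      finally show ?thesis .
    qed
    also have "\<dots> \<le> max_rat M \<phi> x * emeasure M {x<..<t}"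
      using s by (intro mult_left_mono emeasure_mono) auto
    finally show ?thesis .
  qed
  have "\<exists>s. \<forall>n::nat. s n \<in> \<rat> \<and> t - 1 / Suc n < s n \<and> s n < t"
  proof (intro choice allI)
    fix n :: nat
    have "t - 1 / real (Suc n) < t" by simp
    then show "\<exists>y. y \<in> \<rat> \<and> t - 1 / real (Suc n) < y \<and> y < t"
      using Rats_dense_in_real by blast
  qed
  then obtain s where s: "s n \<in> \<rat>" "t - 1 / Suc n < s n" "s n < t" for n :: nat by auto
  have "(\<integral>\<^sup>+y\<in>{x<..<t}. \<phi> y \<partial>M) \<le> (\<integral>\<^sup>+y. liminf (\<lambda>n. \<phi> y * indicator {x<..s n} y) \<partial>M)"
  proof (rule nn_integral_mono)
    fix y
    show "\<phi> y * indicator {x<..<t} y \<le> liminf (\<lambda>n. \<phi> y * indicator {x<..s n} y)"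
    proof (cases "y \<in> {x<..<t}")
      case True
      then have "0 < t - y" by simp
      then have "eventually (\<lambda>n. 1 / real (Suc n) < t - y) sequentially"
        by real_asymp
      then have "eventually (\<lambda>n. \<phi> y \<le> \<phi> y * indicator {x<..s n} y) sequentially"
      proof eventually_elim
        case (elim n)
        then have "y < s n" using s(2)[of n] by linarith
        then show ?case using True by simp
      qed
      then show ?thesis using True by (simp add: Liminf_bounded)
    qed simp
  qed
  also have "\<dots> \<le> liminf (\<lambda>n. \<integral>\<^sup>+y\<in>{x<..s n}. \<phi> y \<partial>M)"
    by (rule nn_integral_liminf) auto
  also have "\<dots> \<le> max_rat M \<phi> x * emeasure M {x<..<t}"
    using le s by (intro order_trans[OF Liminf_le_Limsup] Limsup_bounded) auto
  finally show ?thesis .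
qed simp

text \<open>A decreasing kernel is a superposition of indicators of intervals starting at
  \<open>x\<close>, each of which the maximal function at \<open>x\<close> controls. Continuity
  makes the superlevel sets open, as \<open>integral_le_max_rat\<close> wants them.\<close>

lemma integral_kernel_le_max_rat:
  assumes [measurable]: "\<phi> \<in> borel_measurable M"
    and k: "continuous_on UNIV k" "antimono k"
  shows "(\<integral>\<^sup>+y\<in>{x<..<b}. ennreal (k y) * \<phi> y \<partial>M)
     \<le> max_rat M \<phi> x * (\<integral>\<^sup>+y\<in>{x<..<b}. ennreal (k y) \<partial>M)"
proof -
  interpret sigma_finite_measure M by (rule sigma_finite)
  interpret pair_sigma_finite M lborel ..
  have "k \<in> borel_measurable borel"
    using k(1) by (rule borel_measurable_continuous_onI)
  then have [measurable]: "k \<in> borel_measurable M"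
    by (rule borel_measurable_M)
  \<comment> \<open>the superlevel sets of the decreasing kernel are intervals starting at \<open>x\<close>\<close>
  define A where "A = (\<lambda>l. {y. x < y \<and> y < b \<and> l < k y})"
  have A: "\<exists>t. A l = {x<..<t}" for l
  proof (cases "A l = {}")
    case True
    then have "A l = {x<..<x}" by simp
    then show ?thesis by blast
  next
    case ne: False
    have bdd: "bdd_above (A l)" unfolding A_def by (intro bdd_aboveI[of _ b]) auto
    have op: "open (A l)"
    proof -
      have "A l = {x<..<b} \<inter> {y. l < k y}" by (auto simp: A_def)
      moreover have "open {y. l < k y}"
        using k(1) by (intro open_Collect_less) auto
      ultimately show ?thesis by (metis open_Int open_greaterThanLessThan)
    qed
    have A1: "y \<in> A l" if y: "x < y" "y < Sup (A l)" for y
    proof -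
      obtain z where "z \<in> A l" "y < z" using y less_cSup_iff[OF ne bdd] by auto
      then show ?thesis using y antimonoD[OF k(2), of y z] by (auto simp: A_def)
    qed
    have A2: "y < Sup (A l)" if "y \<in> A l" for y
    proof -
      obtain e where e: "0 < e" "ball y e \<subseteq> A l"
        using op \<open>y \<in> A l\<close> by (rule openE)
      then have "y + e / 2 \<in> A l" by (auto simp: subset_iff dist_real_def)
      from cSup_upper[OF this bdd] show ?thesis using e by simp
    qed
    have "x < y" if "y \<in> A l" for y using that by (simp add: A_def)
    then have "A l = {x<..<Sup (A l)}"
      using A1 A2 by (intro equalityI subsetI greaterThanLessThan_iff[THEN iffD2] conjI) simp_all
    then show ?thesis by blast
  qed
  have eq: "(if x < y \<and> y < b \<and> 0 < l \<and> l < k y then 1 else 0 :: ennreal) = (if 0 < l then 1 else 0) * indicator (A l) y" for l y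
    by (simp add: A_def)
  have layer: "(\<integral>\<^sup>+y\<in>{x<..<b}. ennreal (k y) * f y \<partial>M) = (\<integral>\<^sup>+l. (if 0 < l then 1 else 0) * (\<integral>\<^sup>+y\<in>A l. f y \<partial>M) \<partial>lborel)"
    if [measurable]: "f \<in> borel_measurable M" for f
  proof -
    have "(\<integral>\<^sup>+y\<in>{x<..<b}. ennreal (k y) * f y \<partial>M)
        = (\<integral>\<^sup>+y. (\<integral>\<^sup>+l. f y * (if x < y \<and> y < b \<and> 0 < l \<and> l < k y then 1 else 0) \<partial>lborel) \<partial>M)"
    proof (rule nn_integral_cong)
      fix y
      have "(\<integral>\<^sup>+l. f y * (if x < y \<and> y < b \<and> 0 < l \<and> l < k y then 1 else 0) \<partial>lborel)
          = (\<integral>\<^sup>+l. (f y * indicator {x<..<b} y) * indicator {0<..<k y} l \<partial>lborel)"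
        by (intro nn_integral_cong) (auto split: split_indicator)
      also have "\<dots> = ennreal (k y) * f y * indicator {x<..<b} y"
      proof -
        have "emeasure lborel {0<..<k y} = ennreal (k y)"
          by (cases "0 \<le> k y") (auto simp: ennreal_neg)
        then show ?thesis
          by (subst nn_integral_cmult_indicator) (auto simp: mult_ac)
      qed
      finally show "ennreal (k y) * f y * indicator {x<..<b} y
          = (\<integral>\<^sup>+l. f y * (if x < y \<and> y < b \<and> 0 < l \<and> l < k y then 1 else 0) \<partial>lborel)" by simp
    qed
    also have "\<dots> = (\<integral>\<^sup>+l. (\<integral>\<^sup>+y. f y * (if x < y \<and> y < b \<and> 0 < l \<and> l < k y then 1 else 0) \<partial>M) \<partial>lborel)"
      by (rule Fubini'[symmetric]) measurable
    also have "\<dots> = (\<integral>\<^sup>+l. (if 0 < l then 1 else 0) * (\<integral>\<^sup>+y\<in>A l. f y \<partial>M) \<partial>lborel)"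
      unfolding eq by (intro nn_integral_cong) auto
    finally show ?thesis .
  qed
  have [measurable]: "(\<lambda>l. emeasure M (A l)) \<in> borel_measurable lborel"
  proof -
    have "(\<lambda>l. \<integral>\<^sup>+y. (if x < y \<and> y < b \<and> l < k y then 1 else 0) \<partial>M) \<in> borel_measurable lborel"
      by measurable
    moreover have "(\<integral>\<^sup>+y. (if x < y \<and> y < b \<and> l < k y then 1 else 0) \<partial>M) = emeasure M (A l)" for l
    proof -
      have "A l \<in> sets M" using A[of l] by auto
      then have "emeasure M (A l) = (\<integral>\<^sup>+y. indicator (A l) y \<partial>M)" by simp
      also have "\<dots> = (\<integral>\<^sup>+y. (if x < y \<and> y < b \<and> l < k y then 1 else 0) \<partial>M)"
        by (intro nn_integral_cong) (auto simp: A_def)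
      finally show ?thesis by simp
    qed
    ultimately show ?thesis by simp
  qed
  have le: "(\<integral>\<^sup>+y\<in>A l. \<phi> y \<partial>M) \<le> max_rat M \<phi> x * emeasure M (A l)" for l
    using A[of l] integral_le_max_rat[of \<phi> x] by auto
  have ems: "(\<integral>\<^sup>+y\<in>A l. 1 \<partial>M) = emeasure M (A l)" for l
    using A[of l] by auto
  have "(\<integral>\<^sup>+y\<in>{x<..<b}. ennreal (k y) * \<phi> y \<partial>M)
      = (\<integral>\<^sup>+l. (if 0 < l then 1 else 0) * (\<integral>\<^sup>+y\<in>A l. \<phi> y \<partial>M) \<partial>lborel)"
    by (rule layer) measurable
  also have "\<dots> \<le> (\<integral>\<^sup>+l. max_rat M \<phi> x * ((if 0 < l then 1 else 0) * emeasure M (A l)) \<partial>lborel)"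
    using le by (intro nn_integral_mono) auto
  also have "\<dots> = max_rat M \<phi> x * (\<integral>\<^sup>+l. (if 0 < l then 1 else 0) * emeasure M (A l) \<partial>lborel)"
    by (rule nn_integral_cmult) measurable
  also have "(\<integral>\<^sup>+l. (if 0 < l then 1 else 0) * emeasure M (A l) \<partial>lborel) = (\<integral>\<^sup>+y\<in>{x<..<b}. ennreal (k y) \<partial>M)"
    using layer[of "\<lambda>_. 1"] unfolding ems by simp
  finally show ?thesis .
qed

end

subsection \<open>The pointwise estimate\<close>

text \<open>For a maximizer \<open>b\<close> of \<open>H\<close>, the inequality
  \<open>H y \<le> H b\<close> cancels the mass of \<open>{x<..y}\<close>, on which nothing is
  known. On the left half \<open>(y - x) powr \<beta>\<close> is at most
  \<open>(1 / 2) powr \<beta> * (b - x) powr \<beta>\<close>; this is the source of the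
  constant.\<close>

lemma (in diffuse_measure) measure_Ioc_ge_of_max:
  assumes l: "0 < l" and b: "0 < \<beta>" and t: "x < t" "l * (t - x) powr \<beta> < measure M {x<..t}"
  obtains b where "x < b"
    "\<And>y. x \<le> y \<Longrightarrow> y \<le> (x + b) / 2 \<Longrightarrow> l * (1 - (1 / 2) powr \<beta>) * (b - x) powr \<beta> \<le> measure M {y<..b}"
proof -
  define H where "H = (\<lambda>s. measure M {x<..s} - l * (s - x) powr \<beta>)"
  have "continuous_on {x..t} H"
    unfolding H_def using b
    by (intro continuous_intros continuous_on_subset[OF continuous_measure_Ioc(1)] continuous_on_powr') auto
  then obtain b where b': "b \<in> {x..t}" "\<And>y. y \<in> {x..t} \<Longrightarrow> H y \<le> H b"
    using continuous_attains_sup[of "{x..t}" H] t by auto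
  have "0 < H b" using b'(2)[of t] t by (simp add: H_def)
  then have xb: "x < b" using b' by (cases "x = b") (auto simp: H_def)
  show thesis
  proof (rule that[OF xb])
    fix y assume y: "x \<le> y" "y \<le> (x + b) / 2"
    then have yb: "y \<le> b" using xb by simp
    have "H y \<le> H b" using y yb b' by auto
    then have "l * ((b - x) powr \<beta> - (y - x) powr \<beta>) \<le> measure M {y<..b}"
      using measure_Ioc_split[OF y(1) yb] by (simp add: H_def algebra_simps)
    moreover have "(y - x) powr \<beta> \<le> ((1 / 2) * (b - x)) powr \<beta>"
      using y b by (intro powr_mono2) auto
    then have "(y - x) powr \<beta> \<le> (1 / 2) powr \<beta> * (b - x) powr \<beta>"
      using xb by (subst (asm) powr_mult) auto
    then have "l * ((1 - (1 / 2) powr \<beta>) * (b - x) powr \<beta>) \<le> l * ((b - x) powr \<beta> - (y - x) powr \<beta>)"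
      using l by (intro mult_left_mono) (auto simp: algebra_simps)
    ultimately show "l * (1 - (1 / 2) powr \<beta>) * (b - x) powr \<beta> \<le> measure M {y<..b}"
      by (simp add: mult.assoc)
  qed
qed

text \<open>Two interleaved telescoping sums. Successive pieces in \<open>one_sided_testing\<close>
  are bounded by lengths of overlapping intervals from \<open>z k\<close> to
  \<open>z (k + 2)\<close>.\<close>

lemma sum_skip_diff:
  fixes z :: "nat \<Rightarrow> real"
  shows "(\<Sum>k<n. z (k + 2) - z k) = z (n + 1) + z n - z 1 - z 0"
  by (induction n) auto

text \<open>The \<open>T\<close>-mass of \<open>(z\<^sub>k, b]\<close> is halved in each step, so on \<open>(z\<^sub>k, z\<^sub>k\<^sub>+\<^sub>1]\<close> it is comparable to the mass of
  \<open>(z\<^sub>k\<^sub>+\<^sub>1, z\<^sub>k\<^sub>+\<^sub>2]\<close>; the bounds of the pieces then telescope.\<close>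

lemma one_sided_testing:
  fixes U T :: "real measure"
  assumes "diffuse_measure U" "diffuse_measure T"
    and pos: "\<And>a b. a < b \<Longrightarrow> 0 < measure T {a<..b}"
    and m: "0 < m" and K: "0 \<le> K"
    and A: "\<And>a b c. a < b \<Longrightarrow> b < c \<Longrightarrow>
      measure U {a<..b} * measure T {b<..c} powr m \<le> K * (c - a) powr (m + 1)"
    and xb: "x < b"
  shows "(\<integral>\<^sup>+y\<in>{x<..<b}. ennreal (measure T {y<..b} powr m) \<partial>U)
    \<le> ennreal (2 * 4 powr m * K * (b - x) powr (m + 1))"
proof -
  interpret U: diffuse_measure U by fact
  interpret T: diffuse_measure T by fact
  define S where "S = (\<lambda>y. measure T {y<..b})"
  have S_less: "S z < S y" if "y < z" "z \<le> b" for y z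
    using T.measure_Ioc_split[of y z b] pos[of y z] that by (simp add: S_def)
  have S_le: "S z \<le> S y" if "y \<le> z" for y z
    using that unfolding S_def by (intro T.measure_Ioc_mono) auto
  have Sb: "S b = 0" by (simp add: S_def)
  have Sx: "0 < S x" using pos[OF xb] by (simp add: S_def)
  have "\<exists>z. x \<le> z \<and> z \<le> b \<and> S z = S x / 2 ^ k" for k :: nat
  proof (rule IVT2')
    show "S b \<le> S x / 2 ^ k" using Sb Sx by simp
    show "S x / 2 ^ k \<le> S x" using Sx by (simp add: field_simps)
    show "continuous_on {x..b} S"
      unfolding S_def by (rule continuous_on_subset[OF T.continuous_measure_Ioc(2)]) simp
  qed (use xb in simp)
  then obtain z where z: "x \<le> z k" "z k \<le> b" "S (z k) = S x / 2 ^ k" for k :: nat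
    by metis
  have z_mono: "z k < z (Suc k)" for k
  proof (rule ccontr)
    assume "\<not> z k < z (Suc k)"
    then have "S (z k) \<le> S (z (Suc k))" by (intro S_le) simp
    then show False using z(3)[of k] z(3)[of "Suc k"] Sx by (simp add: field_simps)
  qed
  have z0: "z 0 = x"
    using S_less[of x "z 0"] z[of 0] by (cases "x < z 0") auto
  \<comment> \<open>The mass remaining at a point \<open>y < b\<close> is positive, hence reached
    after finitely many halvings; the pieces exhaust the open interval.\<close>
  have cover: "\<exists>k. z k < y \<and> y \<le> z (Suc k)" if y: "x < y" "y < b" for y
  proof -
    have Sy: "0 < S y" "S y < S x" using S_less[of y b] S_less[of x y] y Sb by auto
    have "\<exists>k. S x / 2 ^ Suc k \<le> S y"
    proof -
      obtain n where "S x / S y < 2 ^ n"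
        using real_arch_pow[of 2 "S x / S y"] by auto
      then have "S x / 2 ^ Suc n \<le> S y"
        using Sy Sx by (simp add: field_simps)
      then show ?thesis by blast
    qed
    then obtain k where k: "S x / 2 ^ Suc k \<le> S y" "\<And>j. j < k \<Longrightarrow> \<not> S x / 2 ^ Suc j \<le> S y"
      by (subst (asm) exists_least_iff) blast
    have "S y < S x / 2 ^ k"
      using k(2)[of "k - 1"] Sy by (cases k) auto
    then have "z k < y" using S_le[of y "z k"] z(3)[of k] by (cases "z k < y") auto
    moreover have "y \<le> z (Suc k)"
      using S_less[of "z (Suc k)" y] z(3)[of "Suc k"] k(1) y by (cases "y \<le> z (Suc k)") auto
    ultimately show ?thesis by blast
  qed
  define C where "C = 4 powr m * K * (b - x) powr m"
  have C: "0 \<le> C" using K by (simp add: C_def)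
  \<comment> \<open>The masses remaining at the next two points are a half and a quarter of
    \<open>S (z k)\<close>, so the next piece carries a quarter: hence \<open>4 powr m\<close>. Of
    the \<open>m + 1\<close> powers of the length, \<open>m\<close> are bounded by those of
    \<open>b - x\<close>, and the last one is kept for telescoping.\<close>
  have step: "S (z k) powr m * measure U {z k<..z (Suc k)} \<le> C * (z (k + 2) - z k)" for k
  proof -
    have "measure T {z (Suc k)<..z (k + 2)} = S (z (Suc k)) - S (z (k + 2))"
      using T.measure_Ioc_split[of "z (Suc k)" "z (k + 2)" b] z(2) z_mono[of "Suc k"]
      by (simp add: S_def)
    moreover have "S (z (Suc k)) = S (z k) / 2" "S (z (k + 2)) = S (z k) / 4"
      by (simp_all add: z(3))
    ultimately have "S (z k) = 4 * measure T {z (Suc k)<..z (k + 2)}" by simp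
    then have "S (z k) powr m * measure U {z k<..z (Suc k)}
        = 4 powr m * (measure U {z k<..z (Suc k)} * measure T {z (Suc k)<..z (k + 2)} powr m)"
      by (simp add: powr_mult)
    also have "\<dots> \<le> 4 powr m * (K * (z (k + 2) - z k) powr (m + 1))"
      using z_mono[of k] z_mono[of "Suc k"] by (intro mult_left_mono A) auto
    also have "\<dots> = 4 powr m * K * ((z (k + 2) - z k) powr m * (z (k + 2) - z k))"
      using z_mono[of k] z_mono[of "Suc k"] by (simp add: powr_add)
    also have "\<dots> \<le> 4 powr m * K * ((b - x) powr m * (z (k + 2) - z k))"
      using z(1)[of k] z(2)[of "k + 2"] z_mono[of k] z_mono[of "Suc k"] m K
      by (intro mult_left_mono mult_right_mono powr_mono2) auto
    finally show ?thesis by (simp add: C_def mult.assoc)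
  qed
  have "(\<integral>\<^sup>+y\<in>{x<..<b}. ennreal (S y powr m) \<partial>U)
      \<le> (\<integral>\<^sup>+y. (\<Sum>k. ennreal (S (z k) powr m) * indicator {z k<..z (Suc k)} y) \<partial>U)"
  proof (rule nn_integral_mono)
    fix y
    show "ennreal (S y powr m) * indicator {x<..<b} y
        \<le> (\<Sum>k. ennreal (S (z k) powr m) * indicator {z k<..z (Suc k)} y)"
    proof (cases "y \<in> {x<..<b}")
      case True
      then obtain k where k: "z k < y" "y \<le> z (Suc k)" using cover[of y] by auto
      have "ennreal (S y powr m) \<le> ennreal (S (z k) powr m)"
        using S_le[of "z k" y] k m by (intro ennreal_leI powr_mono2) (auto simp: S_def)
      also have "\<dots> = (\<Sum>k\<in>{k}. ennreal (S (z k) powr m) * indicator {z k<..z (Suc k)} y)"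
        using k by simp
      also have "\<dots> \<le> (\<Sum>k. ennreal (S (z k) powr m) * indicator {z k<..z (Suc k)} y)"
        by (rule sum_le_suminf) auto
      finally show ?thesis using True by simp
    qed simp
  qed
  also have "\<dots> = (\<Sum>k. ennreal (S (z k) powr m) * emeasure U {z k<..z (Suc k)})"
    by (subst nn_integral_suminf) (auto simp: nn_integral_cmult_indicator)
  also have "\<dots> = (\<Sum>k. ennreal (S (z k) powr m * measure U {z k<..z (Suc k)}))"
    by (simp add: U.emeasure_Ioc ennreal_mult)
  also have "\<dots> \<le> ennreal (C * (2 * (b - x)))"
    unfolding suminf_eq_SUP
  proof (rule SUP_least)
    fix n
    have "(\<Sum>k<n. ennreal (S (z k) powr m * measure U {z k<..z (Suc k)}))
        = ennreal (\<Sum>k<n. S (z k) powr m * measure U {z k<..z (Suc k)})"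
      by (rule sum_ennreal) simp
    also have "(\<Sum>k<n. S (z k) powr m * measure U {z k<..z (Suc k)}) \<le> (\<Sum>k<n. C * (z (k + 2) - z k))"
      by (intro sum_mono step)
    also have "\<dots> = C * (z (n + 1) + z n - z 1 - z 0)"
      by (simp only: sum_distrib_left[symmetric] sum_skip_diff)
    also have "\<dots> \<le> C * (2 * (b - x))"
      using C z(2)[of n] z(2)[of "n + 1"] z(1)[of 1] z0 by (intro mult_left_mono) auto
    finally show "(\<Sum>k<n. ennreal (S (z k) powr m * measure U {z k<..z (Suc k)})) \<le> ennreal (C * (2 * (b - x)))"
      by (simp add: ennreal_leI)
  qed
  also have "C * (2 * (b - x)) = 2 * 4 powr m * K * (b - x) powr (m + 1)"
    using xb by (simp add: C_def powr_add)
  finally show ?thesis by (simp add: S_def)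
qed

lemma ennreal_leI_dense:
  fixes X Z :: ennreal
  assumes "\<And>l. 0 < l \<Longrightarrow> ennreal l < X \<Longrightarrow> ennreal l \<le> Z"
  shows "X \<le> Z"
proof (rule dense_le)
  fix y assume y: "y < X"
  show "y \<le> Z"
  proof (cases y)
    case (real l)
    then show ?thesis using assms[of l] y by (cases "l = 0") auto
  qed (use y in auto)
qed

lemma (in diffuse_measure) emeasure_Ioo: "emeasure M {a<..<b} = emeasure M {a<..b}"
proof (cases "a < b")
  case True
  then have "{a<..b} = {b} \<union> {a<..<b}" by auto
  moreover have "{b} \<inter> {a<..<b} = {}" by auto
  moreover have "{b} \<in> sets M" by (intro sets_M_borel) simp
  ultimately show ?thesis
    using plus_emeasure[of "{b}" M "{a<..<b}"] by (simp add: no_atoms)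
qed simp

text \<open>Hoelder's inequality for the product of \<open>g * w\<close> and \<open>1 / w\<close>,
  obtained from Young's inequality with values in \<open>ennreal\<close>, so that integrability of
  \<open>g\<close> on \<open>A\<close> is a conclusion.\<close>

lemma nn_integral_Holder_weight:
  fixes g w :: "real \<Rightarrow> real"
  assumes [measurable]: "g \<in> borel_measurable M" "w \<in> borel_measurable M" "A \<in> sets M"
    and w: "AE x in M. 0 < w x" and g: "\<And>x. 0 \<le> g x"
    and p: "1 < p" and p': "p' = p / (p - 1)"
    and norm: "(\<integral>\<^sup>+x. ennreal (g x powr p * w x powr p) \<partial>M) \<le> 1"
    and tau: "(\<integral>\<^sup>+x\<in>A. ennreal (w x powr - p') \<partial>M) = ennreal t" "0 < t"
  shows "(\<integral>\<^sup>+x\<in>A. ennreal (g x) \<partial>M) \<le> ennreal (t powr (1 / p'))"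
proof -
  have p'1: "1 < p'" "1 / p + 1 / p' = 1"
    using p by (auto simp: p' field_simps)
  \<comment> \<open>this scaling optimizes Young's inequality\<close>
  define l where "l = t powr (1 / (p * p'))"
  have l: "0 < l" using tau by (simp add: l_def)
  have young: "y \<le> l powr p / p * (y powr p * z powr p) + l powr (- p') / p' * z powr - p'"
    if "0 < z" "0 \<le> y" for y z :: real
  proof -
    have "y = (y * z * l) * (1 / (z * l))" using that l by simp
    also have "\<dots> \<le> (y * z * l) powr p / p + (1 / (z * l)) powr p' / p'"
      using that l p p'1 by (intro Youngs_inequality) auto
    also have "\<dots> = l powr p / p * (y powr p * z powr p) + l powr (- p') / p' * z powr - p'"
      using that l by (simp add: powr_mult powr_divide powr_minus field_simps)
    finally show ?thesis .
  qed
  have "(\<integral>\<^sup>+x\<in>A. ennreal (g x) \<partial>M)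
      \<le> (\<integral>\<^sup>+x. ennreal (l powr p / p) * ennreal (g x powr p * w x powr p)
            + ennreal (l powr (- p') / p') * (ennreal (w x powr - p') * indicator A x) \<partial>M)"
  proof (rule nn_integral_mono_AE)
    show "AE x in M. ennreal (g x) * indicator A x
        \<le> ennreal (l powr p / p) * ennreal (g x powr p * w x powr p)
          + ennreal (l powr (- p') / p') * (ennreal (w x powr - p') * indicator A x)"
      using w
    proof eventually_elim
      case (elim x)
      show ?case
        using young[OF elim g] p p'1
        by (auto split: split_indicator simp flip: ennreal_mult ennreal_plus intro!: ennreal_leI)
    qed
  qed
  also have "\<dots> = ennreal (l powr p / p) * (\<integral>\<^sup>+x. ennreal (g x powr p * w x powr p) \<partial>M)
      + ennreal (l powr (- p') / p') * ennreal t"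
    by (simp add: nn_integral_add nn_integral_cmult tau(1))
  also have "\<dots> \<le> ennreal (l powr p / p) * 1 + ennreal (l powr (- p') / p') * ennreal t"
    using norm by (intro add_mono mult_left_mono) auto
  also have "\<dots> = ennreal (l powr p / p + l powr (- p') / p' * t)"
    using p p'1 tau by (simp flip: ennreal_mult ennreal_plus)
  also have "l powr p / p + l powr (- p') / p' * t = t powr (1 / p')"
  proof -
    have "l powr p = t powr (1 / p')"
      using p by (simp add: l_def powr_powr)
    moreover have "l powr (- p') * t = t powr (1 / p')"
    proof -
      have "l powr (- p') * t = t powr (- (1 / p)) * t powr 1"
        using p p'1 tau by (simp add: l_def powr_powr)
      also have "\<dots> = t powr (1 / p')"
      proof -
        have "- (1 / p) + 1 = 1 / p'" using p'1 by linarith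
        then show ?thesis by (simp only: powr_add[symmetric])
      qed
      finally show ?thesis .
    qed
    ultimately have "l powr p / p + l powr (- p') / p' * t = t powr (1 / p') * (1 / p + 1 / p')"
      by (simp add: field_simps)
    then show ?thesis using p'1 by simp
  qed
  finally show ?thesis .
qed

text \<open>Passes from Lebesgue measure to a weighted one, so that the maximal functions of the
  weighted measures become applicable; the weight vanishes at most on a null set.\<close>

lemma nn_integral_density_quotient:
  fixes u :: "real \<Rightarrow> real"
  assumes [measurable]: "u \<in> borel_measurable M" "h \<in> borel_measurable M" "k \<in> borel_measurable M"
    and u: "AE x in M. 0 < u x"
  shows "(\<integral>\<^sup>+x. k x * (h x / ennreal (u x)) \<partial>density M (\<lambda>x. ennreal (u x))) = (\<integral>\<^sup>+x. k x * h x \<partial>M)"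
proof -
  have "(\<integral>\<^sup>+x. k x * (h x / ennreal (u x)) \<partial>density M (\<lambda>x. ennreal (u x)))
      = (\<integral>\<^sup>+x. ennreal (u x) * (k x * (h x / ennreal (u x))) \<partial>M)"
    by (rule nn_integral_density) measurable
  also have "\<dots> = (\<integral>\<^sup>+x. k x * h x \<partial>M)"
  proof (rule nn_integral_cong_AE)
    show "AE x in M. ennreal (u x) * (k x * (h x / ennreal (u x))) = k x * h x"
      using u
    proof eventually_elim
      case (elim x)
      have "ennreal (u x) * (h x / ennreal (u x)) = h x"
        unfolding ennreal_times_divide mult.commute[of "ennreal (u x)"]
        using elim by (intro ennreal_mult_divide_eq) auto
      then show ?case by (metis mult.left_commute)
    qed
  qed
  finally show ?thesis .
qed

text \<open>The power \<open>m / \<beta>\<close> is dictated by homogeneity: it turns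
  \<open>(d - x) powr \<beta>\<close> into \<open>(d - x) powr m\<close>, and integration over the
  left half supplies one more factor. This matches the power \<open>m + 1\<close> in the testing
  bound, so the interval length cancels.\<close>

lemma frac_max_plus_pointwise:
  fixes v \<sigma> g :: "real \<Rightarrow> real"
  defines "U \<equiv> density lebesgue (\<lambda>x. ennreal (v x))"
    and "T \<equiv> density lebesgue (\<lambda>x. ennreal (\<sigma> x))"
    and "N \<equiv> density lebesgue (\<lambda>x. ennreal (g x))"
  defines "G \<equiv> max_rat T (\<lambda>y. ennreal (g y) / ennreal (\<sigma> y))"
  assumes [measurable]: "v \<in> borel_measurable lebesgue" "\<sigma> \<in> borel_measurable lebesgue" "g \<in> borel_measurable lebesgue"
    and "AE x in lebesgue. 0 < v x" "AE x in lebesgue. 0 < \<sigma> x" and g: "\<And>x. 0 \<le> g x"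
    and "diffuse_measure U" "diffuse_measure T" "diffuse_measure N"
    and pos: "\<And>a b. a < b \<Longrightarrow> 0 < measure T {a<..b}"
    and K: "0 \<le> K"
    and A: "\<And>a b c. a < b \<Longrightarrow> b < c \<Longrightarrow>
      measure U {a<..b} * measure T {b<..c} powr m \<le> K * (c - a) powr (m + 1)"
    and Holder: "\<And>a b. a < b \<Longrightarrow> measure N {a<..b} \<le> measure T {a<..b} powr (1 / p')"
    and b: "0 < \<beta>" and p: "1 < p" "p - 1 < m" "0 < p'" and exps: "(p - 1) + (m - (p - 1)) / p' = m * \<beta>"
  shows "ennpow (frac_max_plus (1 - \<beta>) g x) (m / \<beta>)
    \<le> max_rat U (\<lambda>y. ennpow (G y) ((p - 1) / \<beta>) / ennreal (v y)) x
       * ennreal (4 * 4 powr m / (1 - (1 / 2) powr \<beta>) powr (m / \<beta>) * K)"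
proof -
  interpret U: diffuse_measure U by fact
  interpret T: diffuse_measure T by fact
  interpret N: diffuse_measure N by fact
  define c1 where "c1 = 1 - (1 / 2) powr \<beta>"
  have c1: "0 < c1" using b powr_less_mono2[of \<beta> "1 / 2" 1] by (simp add: c1_def)
  have m: "0 < m" using p by simp
  define Q where "Q = (\<lambda>y. ennpow (G y) ((p - 1) / \<beta>))"
  have "G \<in> borel_measurable T"
    unfolding G_def by (rule T.max_rat_measurable) (simp add: T_def)
  then have [measurable]: "G \<in> borel_measurable lebesgue" by (simp add: T_def)
  have [measurable]: "Q \<in> borel_measurable lebesgue" unfolding Q_def by measurable
  define R where "R = max_rat U (\<lambda>y. Q y / ennreal (v y)) x"
  have NT: "emeasure N {y<..b} \<le> G y * emeasure T {y<..b}" for y b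
  proof -
    have "emeasure N {y<..<b} = (\<integral>\<^sup>+z. indicator {y<..<b} z * ennreal (g z) \<partial>lebesgue)"
      unfolding N_def by (subst emeasure_density) (auto simp: mult.commute)
    also have "\<dots> = (\<integral>\<^sup>+z. indicator {y<..<b} z * (ennreal (g z) / ennreal (\<sigma> z)) \<partial>T)"
      unfolding T_def using assms by (intro nn_integral_density_quotient[symmetric]) auto
    also have "\<dots> \<le> G y * emeasure T {y<..<b}"
      using T.integral_le_max_rat[of "\<lambda>z. ennreal (g z) / ennreal (\<sigma> z)" y b]
      by (simp add: G_def T_def mult.commute)
    finally show ?thesis by (simp add: N.emeasure_Ioo T.emeasure_Ioo)
  qed
  have main: "ennreal (l powr (m / \<beta>)) \<le> R * ennreal (4 * 4 powr m / c1 powr (m / \<beta>) * K)"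
    if l: "0 < l" "ennreal l < frac_max_plus (1 - \<beta>) g x" for l
  proof -
    obtain h where h: "0 < h" "ennreal l < ennreal (1 / h powr \<beta>) * (\<integral>\<^sup>+t\<in>{x..x+h}. ennreal (g t) \<partial>lebesgue)"
      using l(2) g unfolding frac_max_plus_def less_SUP_iff by auto
    have "(\<integral>\<^sup>+t\<in>{x..x+h}. ennreal (g t) \<partial>lebesgue) = emeasure N {x..x+h}"
      unfolding N_def by (subst emeasure_density) auto
    also have "\<dots> = ennreal (measure N {x<..x+h})"
      using h by (simp add: N.emeasure_Icc N.emeasure_Ioc)
    finally have "ennreal l < ennreal (1 / h powr \<beta> * measure N {x<..x+h})"
      using h by (subst ennreal_mult) auto
    then have "l < 1 / h powr \<beta> * measure N {x<..x+h}"
      using l by (simp add: ennreal_less_iff)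
    then have "l * (x + h - x) powr \<beta> < measure N {x<..x+h}"
      using h by (simp add: field_simps)
    then obtain d where d: "x < d"
      "\<And>y. x \<le> y \<Longrightarrow> y \<le> (x + d) / 2 \<Longrightarrow> l * (1 - (1 / 2) powr \<beta>) * (d - x) powr \<beta> \<le> measure N {y<..d}"
      using N.measure_Ioc_ge_of_max[of l \<beta> x "x + h"] l(1) b h by auto
    define S where "S = (\<lambda>y. measure T {y<..d})"
    define F where "F = l * c1 * (d - x) powr \<beta>"
    have F: "0 \<le> F" using l c1 by (simp add: F_def)
    have pt: "ennreal (F powr (m / \<beta>)) \<le> ennreal (S y powr m) * Q y" if y: "x < y" "y < (x + d) / 2" for y
    proof -
      define n where "n = measure N {y<..d}"
      \<comment> \<open>\<open>a\<close> is the share of \<open>m / \<beta>\<close> estimated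
        through \<open>G\<close>, and \<open>e\<close> the share estimated through
        \<open>Holder\<close>. By \<open>exps\<close> the resulting powers of \<open>S y\<close>
        combine to \<open>m\<close>.\<close>
      define a where "a = (p - 1) / \<beta>"
      define e where "e = (m - (p - 1)) / \<beta>"
      have "a + 1 / p' * e = ((p - 1) + (m - (p - 1)) / p') / \<beta>"
        by (simp add: a_def e_def add_divide_distrib)
      then have ae: "0 < a" "0 < e" "m / \<beta> = a + e" "a + 1 / p' * e = m"
        using p b unfolding exps by (auto simp: a_def e_def simp flip: add_divide_distrib)
      have yd: "y < d" using y d by simp
      have "F \<le> n" using d(2)[of y] y by (simp add: F_def n_def c1_def)
      then have "ennreal (F powr (m / \<beta>)) \<le> ennpow (ennreal n) (a + e)"
        using F m b ae by (simp add: ennpow_ennreal n_def ennreal_leI powr_mono2)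
      also have "\<dots> = ennpow (ennreal n) a * ennpow (ennreal n) e"
        by (rule ennpow_add)
      also have "\<dots> \<le> ennpow (G y * ennreal (S y)) a * ennpow (ennreal (S y powr (1 / p'))) e"
      proof (intro mult_mono ennpow_mono)
        show "ennreal n \<le> G y * ennreal (S y)"
          using NT[of y d] by (simp add: n_def S_def N.emeasure_Ioc T.emeasure_Ioc)
        show "ennreal n \<le> ennreal (S y powr (1 / p'))"
          using Holder[OF yd] by (simp add: n_def S_def ennreal_leI)
      qed (use ae in auto)
      also have "\<dots> = Q y * (ennreal (S y powr a) * ennreal (S y powr (1 / p' * e)))"
        by (simp add: ennpow_mult ennpow_ennreal S_def Q_def a_def powr_powr mult.assoc)
      also have "ennreal (S y powr a) * ennreal (S y powr (1 / p' * e)) = ennreal (S y powr m)"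
        by (simp only: powr_add[symmetric] ennreal_mult[symmetric] powr_ge_zero ae(4))
      finally show ?thesis by (simp add: mult.commute)
    qed
    \<comment> \<open>The bound holds on the whole left half, so integrating it costs a factor 2
      only. Rewriting the integral against \<open>U\<close> brings in the maximal function
      \<open>R\<close>.\<close>
    have "ennreal (F powr (m / \<beta>)) * ennreal ((d - x) / 2)
        = (\<integral>\<^sup>+y. ennreal (F powr (m / \<beta>)) * indicator {x<..<(x + d) / 2} y \<partial>lebesgue)"
      using d by (subst nn_integral_cmult_indicator) (auto simp: field_simps)
    also have "\<dots> \<le> (\<integral>\<^sup>+y. (ennreal (S y powr m) * indicator {x<..<d} y) * Q y \<partial>lebesgue)"
      using pt d by (intro nn_integral_mono) (auto split: split_indicator)
    also have "\<dots> = (\<integral>\<^sup>+y. (ennreal (S y powr m) * indicator {x<..<d} y) * (Q y / ennreal (v y)) \<partial>U)"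
    proof -
      have "S \<in> borel_measurable borel"
        unfolding S_def by (rule borel_measurable_continuous_onI[OF T.continuous_measure_Ioc(2)])
      then have [measurable]: "S \<in> borel_measurable lebesgue"
        by (intro measurable_completion) simp
      show ?thesis
        unfolding U_def using assms by (intro nn_integral_density_quotient[symmetric]) auto
    qed
    also have "\<dots> = (\<integral>\<^sup>+y\<in>{x<..<d}. ennreal (S y powr m) * (Q y / ennreal (v y)) \<partial>U)"
      by (intro nn_integral_cong) (auto split: split_indicator)
    also have "\<dots> \<le> R * (\<integral>\<^sup>+y\<in>{x<..<d}. ennreal (S y powr m) \<partial>U)"
      unfolding R_def
    proof (rule U.integral_kernel_le_max_rat)
      show "(\<lambda>y. Q y / ennreal (v y)) \<in> borel_measurable U" unfolding U_def by measurable
      show "continuous_on UNIV (\<lambda>y. S y powr m)"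
        unfolding S_def using m by (intro continuous_on_powr' T.continuous_measure_Ioc(2) continuous_intros) auto
      show "antimono (\<lambda>y. S y powr m)"
        using m by (intro antimonoI powr_mono2) (auto simp: S_def intro!: T.measure_Ioc_mono)
    qed
    also have "\<dots> \<le> R * ennreal (2 * 4 powr m * K * (d - x) powr (m + 1))"
      unfolding S_def using one_sided_testing[OF _ _ pos m K A d(1)] U.diffuse_measure_axioms T.diffuse_measure_axioms
      by (intro mult_left_mono) auto
    finally have le: "ennreal (F powr (m / \<beta>)) * ennreal ((d - x) / 2) \<le> R * ennreal (2 * 4 powr m * K * (d - x) powr (m + 1))" .
    define D where "D = (d - x) powr (m + 1)"
    have D: "0 < D" using d by (simp add: D_def)
    have c1p: "0 < c1 powr (m / \<beta>)" using c1 by simp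
    \<comment> \<open>The 4 in front of \<open>4 powr m\<close> is 2 from the half interval times 2
      from the testing bound.\<close>
    have "F powr (m / \<beta>) * (d - x) = l powr (m / \<beta>) * c1 powr (m / \<beta>) * D"
      using l c1 d b m by (simp add: F_def D_def powr_mult powr_powr powr_add)
    then have "ennreal (l powr (m / \<beta>)) = ennreal (2 / (c1 powr (m / \<beta>) * D)) * (ennreal (F powr (m / \<beta>)) * ennreal ((d - x) / 2))"
      using d D c1p by (simp flip: ennreal_mult add: mult_ac)
    also have "\<dots> \<le> ennreal (2 / (c1 powr (m / \<beta>) * D)) * (R * ennreal (2 * 4 powr m * K * D))"
      using le by (intro mult_left_mono) (auto simp: D_def)
    also have "\<dots> = R * (ennreal (2 / (c1 powr (m / \<beta>) * D)) * ennreal (2 * 4 powr m * K * D))"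
      by (simp add: mult_ac)
    also have "ennreal (2 / (c1 powr (m / \<beta>) * D)) * ennreal (2 * 4 powr m * K * D) = ennreal (4 * 4 powr m / c1 powr (m / \<beta>) * K)"
      using D c1p K by (simp flip: ennreal_mult add: field_simps)
    finally show ?thesis .
  qed
  have "frac_max_plus (1 - \<beta>) g x \<le> ennpow (R * ennreal (4 * 4 powr m / c1 powr (m / \<beta>) * K)) (\<beta> / m)"
  proof (rule ennreal_leI_dense)
    fix l assume l: "0 < l" "ennreal l < frac_max_plus (1 - \<beta>) g x"
    have "ennreal l = ennpow (ennreal (l powr (m / \<beta>))) (\<beta> / m)"
      using l b m by (simp add: ennpow_ennreal powr_powr)
    also have "\<dots> \<le> ennpow (R * ennreal (4 * 4 powr m / c1 powr (m / \<beta>) * K)) (\<beta> / m)"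
      using main[OF l] b m by (intro ennpow_mono) auto
    finally show "ennreal l \<le> \<dots>" .
  qed
  then have "ennpow (frac_max_plus (1 - \<beta>) g x) (m / \<beta>)
      \<le> ennpow (ennpow (R * ennreal (4 * 4 powr m / c1 powr (m / \<beta>) * K)) (\<beta> / m)) (m / \<beta>)"
    using b m by (intro ennpow_mono) auto
  also have "\<dots> = R * ennreal (4 * 4 powr m / c1 powr (m / \<beta>) * K)"
    using b m by (simp add: ennpow_ennpow)
  finally show ?thesis by (simp add: R_def Q_def c1_def)
qed

subsection \<open>The upper bound\<close>

lemma diffuse_lebesgue: "diffuse_measure lebesgue"
  by unfold_locales (auto simp: emeasure_lborel_Icc_eq)

lemma nn_integral_Icc_pos:
  fixes u :: "real \<Rightarrow> real"
  assumes [measurable]: "u \<in> borel_measurable lebesgue" and u: "AE x in lebesgue. 0 < u x" and "a < b"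
  shows "0 < (\<integral>\<^sup>+x\<in>{a..b}. ennreal (u x) \<partial>lebesgue)"
proof (rule ccontr)
  have [measurable]: "{a..b} \<in> sets lebesgue" by simp
  assume "\<not> ?thesis"
  then have "(\<integral>\<^sup>+x\<in>{a..b}. ennreal (u x) \<partial>lebesgue) = 0"
    by (simp add: zero_less_iff_neq_zero)
  then have "AE x in lebesgue. ennreal (u x) * indicator {a..b} x = 0"
    by (subst (asm) nn_integral_0_iff_AE) measurable
  with u have "AE x in lebesgue. x \<notin> {a..b}"
    by eventually_elim (auto split: split_indicator_asm)
  then have "{a..b} \<in> null_sets lebesgue"
    by (subst (asm) AE_iff_null_sets[symmetric]) auto
  then show False using \<open>a < b\<close> by auto
qed

text \<open>The characteristic enters linearly in the estimate of the power
  \<open>m / \<beta>\<close> and is then raised to \<open>s\<close> and to \<open>1 / q\<close>;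
  \<open>s / q\<close> is the asserted exponent. The maximal inequalities in \<open>L^s(U)\<close>
  and \<open>L^p(T)\<close> contribute constants depending on \<open>s\<close> and \<open>p\<close>
  only.\<close>

lemma frac_max_plus_bound:
  fixes w f :: "real \<Rightarrow> real" and \<alpha> p q :: real
  defines "p' \<equiv> conj_exp p"
  defines "m \<equiv> q / p'"
  defines "s \<equiv> p' * (1 - \<alpha>)"
  assumes \<alpha>: "0 < \<alpha>" "\<alpha> < 1" and p: "1 < p" "p < 1 / \<alpha>" and q: "1 / p - 1 / q - \<alpha> = 0"
    and w: "w \<in> Apq_plus p q" and f [measurable]: "f \<in> borel_measurable lebesgue"
    and norm: "wnorm p (\<lambda>x. w x powr p) (\<lambda>x. ennreal \<bar>f x\<bar>) \<le> 1"
  shows "wnorm q (\<lambda>x. w x powr q) (frac_max_plus \<alpha> f)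
    \<le> ennreal ((4 * 4 powr m / (1 - (1 / 2) powr (1 - \<alpha>)) powr (m / (1 - \<alpha>))) powr (s / q)
        * ((s * 2 powr s / (s - 1)) * (p * 2 powr p / (p - 1))) powr (1 / q))
      * ennpow (Apq_plus_char p q w) (p' / q * (1 - \<alpha>))"
proof -
  define \<beta> where "\<beta> = 1 - \<alpha>"
  define K where "K = enn2real (Apq_plus_char p q w)"
  define v where "v = (\<lambda>x. w x powr q)"
  define \<sigma> where "\<sigma> = (\<lambda>x. w x powr - p')"
  define g where "g = (\<lambda>x. \<bar>f x\<bar>)"

  \<comment> \<open>Relations between the exponents\<close>
  have \<beta>: "0 < \<beta>" using \<alpha> by (simp add: \<beta>_def)
  have p': "1 < p'" "p' = p / (p - 1)" "1 / p' = 1 - 1 / p" "(p - 1) * p' = p"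
    using p by (auto simp: p'_def conj_exp_def field_simps)
  have iq: "1 / q = 1 / p - \<alpha>" using q by simp
  have "\<alpha> < 1 / p" using p \<alpha> by (simp add: field_simps)
  then have q0: "0 < q" using iq by (metis diff_gt_0_iff_gt zero_less_divide_1_iff)
  have "1 / q < 1 / p" using iq \<alpha> by simp
  then have qp: "p < q" using p q0 by (simp add: field_simps)
  \<comment> \<open>\<open>\<alpha> > 0\<close> forces \<open>p < q\<close>, which leaves a positive
    exponent for Hoelder's inequality in the pointwise estimate.\<close>
  have m: "p - 1 < m" "0 < m"
  proof -
    have "m = (p - 1) * (q / p)" using p by (simp add: m_def p'(2))
    also have "\<dots> > (p - 1) * 1" using p qp by (intro mult_strict_left_mono) auto
    finally show "p - 1 < m" by simp
    then show "0 < m" using p by simp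
  qed
  have \<beta>': "\<beta> = 1 / q + 1 / p'" using iq p'(3) by (simp add: \<beta>_def)
  have qb: "q * \<beta> = m + 1" using q0 by (simp add: \<beta>' m_def distrib_left)
  \<comment> \<open>\<open>s\<close> is conjugate to \<open>m + 1\<close>, hence above 1 as the
    outer maximal inequality requires.\<close>
  have s: "s = (m + 1) / m" "m / \<beta> * s = q" "s = p' * \<beta>"
  proof -
    show s: "s = p' * \<beta>" by (simp add: s_def \<beta>_def)
    show "s = (m + 1) / m" 
    proof -
      have "q = m * p'" using p'(1) by (simp add: m_def)
      then have "m + 1 = m * p' * \<beta>" using qb by simp
      then show ?thesis using m by (simp add: s)
    qed
    show "m / \<beta> * s = q" using \<beta> p'(1) by (simp add: s m_def)
  qed
  have s1: "1 < s" using m by (simp add: s(1))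
  have exps: "(p - 1) + (m - (p - 1)) / p' = m * \<beta>"
  proof -
    have "m * \<beta> = 1 / p' + m / p'" using q0 by (simp add: \<beta>' m_def distrib_left)
    also have "1 / p' = (p - 1) - (p - 1) / p'" using p'(3) p by (simp add: p'(2) field_simps)
    finally show ?thesis by (simp add: diff_divide_distrib)
  qed
  have [measurable]: "w \<in> borel_measurable lebesgue" and wpos: "AE x in lebesgue. 0 < w x"
    and charK: "Apq_plus_char p q w = ennreal K" "0 \<le> K"
    using w by (auto simp: Apq_plus_def weight_def K_def less_top)
  have [measurable]: "v \<in> borel_measurable lebesgue" "\<sigma> \<in> borel_measurable lebesgue"
    "g \<in> borel_measurable lebesgue"
    unfolding v_def \<sigma>_def g_def by measurable
  have vpos: "AE x in lebesgue. 0 < v x" and spos: "AE x in lebesgue. 0 < \<sigma> x"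
    using wpos by (auto simp: v_def \<sigma>_def elim!: eventually_mono)
  have g0: "0 \<le> g x" for x by (simp add: g_def)
  have gnorm: "(\<integral>\<^sup>+x. ennreal (g x powr p * w x powr p) \<partial>lebesgue) \<le> 1"
  proof -
    have "ennpow (\<integral>\<^sup>+x. ennreal (g x powr p * w x powr p) \<partial>lebesgue) (1 / p) \<le> ennpow 1 (1 / p)"
      using norm by (simp add: wnorm_def ennpow_ennreal g_def ennreal_mult)
    then show ?thesis using p by (subst (asm) ennpow_le_ennpow_iff) auto
  qed

  \<comment> \<open>The weighted measures and their local finiteness\<close>
  define I where "I = (\<lambda>u a b. \<integral>\<^sup>+x\<in>{a..b}. ennreal (u x) \<partial>(lebesgue :: real measure))"
  have I_mono: "I u a b \<le> I u a' b'" if "a' \<le> a" "b \<le> b'" for u a b a' b'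
    unfolding I_def using that by (intro nn_integral_mono mult_left_mono) (auto split: split_indicator)
  have char: "(ennreal (1 / h) * I v (x - h) x) * ennpow (ennreal (1 / h) * I \<sigma> x (x + h)) m \<le> ennreal K"
    if "0 < h" for x h
    unfolding charK(1)[symmetric] Apq_plus_char_def I_def v_def \<sigma>_def m_def p'_def
    using that by (intro SUP_upper2[of x] SUP_upper2[of h]) auto
  have Ipos: "0 < I v a b" "0 < I \<sigma> a b" if "a < b" for a b
    unfolding I_def using vpos spos that by (auto intro!: nn_integral_Icc_pos)
  \<comment> \<open>A weight has \<open>w\<close> itself locally integrable. For its powers this
    follows from the finite characteristic: an infinite factor would be multiplied by the positive
    mass of a neighbouring interval.\<close>
  have fin1: "I v a b < \<infinity>" "I \<sigma> a b < \<infinity>" if "a < b" for a b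
  proof -
    define h where "h = b - a"
    have h: "0 < h" using that by (simp add: h_def)
    have ne: "ennreal (1 / h) * I u a b \<noteq> 0" if "I u a b \<noteq> 0" for u a b
      using h that by simp
    show "I v a b < \<infinity>"
    proof (rule ccontr)
      assume "\<not> I v a b < \<infinity>"
      then have "I v (b - h) b = top" by (simp add: h_def less_top[symmetric])
      then show False
        using char[OF h, of b] h ne[of \<sigma> b "b + h"] Ipos(2)[of b "b + h"]
        by (auto simp: ennreal_mult_top ennreal_top_mult ennpow_eq_0_iff top_unique split: if_splits)
    qed
    show "I \<sigma> a b < \<infinity>"
    proof (rule ccontr)
      assume "\<not> I \<sigma> a b < \<infinity>"
      then have "I \<sigma> a (a + h) = top" by (simp add: h_def less_top[symmetric])
      then show False
        using char[OF h, of a] h ne[of v "a - h" a] Ipos(1)[of "a - h" a]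
        by (auto simp: ennreal_mult_top ennreal_top_mult ennpow_eq_0_iff top_unique split: if_splits)
    qed
  qed
  have fin: "I v a b < \<infinity>" "I \<sigma> a b < \<infinity>" for a b
  proof -
    have "a < max a b + 1" "b \<le> max a b + 1" by simp_all
    then show "I v a b < \<infinity>" "I \<sigma> a b < \<infinity>"
      using fin1[of a "max a b + 1"] I_mono[of a a b "max a b + 1"]
      by (blast intro: order.strict_trans1)+
  qed
  define U where "U = density lebesgue (\<lambda>x. ennreal (v x))"
  define T where "T = density lebesgue (\<lambda>x. ennreal (\<sigma> x))"
  define N where "N = density lebesgue (\<lambda>x. ennreal (g x))"
  interpret L: diffuse_measure lebesgue by (rule diffuse_lebesgue)
  interpret U: diffuse_measure U
    unfolding U_def using fin(1) by (intro L.diffuse_density) (auto simp: I_def)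
  interpret T: diffuse_measure T
    unfolding T_def using fin(2) by (intro L.diffuse_density) (auto simp: I_def)
  have UI: "emeasure U {a..b} = I v a b" and TI: "emeasure T {a..b} = I \<sigma> a b"
    and NI: "emeasure N {a..b} = I g a b" for a b
    by (simp_all add: U_def T_def N_def I_def emeasure_density)
  have Tm: "I \<sigma> a b = ennreal (measure T {a<..b})" and Um: "I v a b = ennreal (measure U {a<..b})"
    if "a \<le> b" for a b
    using TI[of a b] UI[of a b] T.emeasure_Icc[OF that] U.emeasure_Icc[OF that]
    by (simp_all add: T.emeasure_Ioc U.emeasure_Ioc)
  have Tpos: "0 < measure T {a<..b}" if "a < b" for a b
    using Ipos(2)[OF that] Tm[of a b] that by simp
  have holder: "I g a b \<le> ennreal (measure T {a<..b} powr (1 / p'))" if "a < b" for a b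
    unfolding I_def
    using nn_integral_Holder_weight[of g lebesgue w "{a..b}" p p' "measure T {a<..b}"]
      wpos g0 p p' gnorm Tm[of a b] Tpos[OF that] that
    by (simp add: I_def \<sigma>_def)
  \<comment> \<open>Hoelder's inequality also yields local integrability of \<open>f\<close>,
    without which \<open>N\<close> would not be locally finite.\<close>
  have finN: "I g a b < \<infinity>" for a b
  proof -
    have "I g a b \<le> I g a (max a b + 1)" by (rule I_mono) auto
    also have "\<dots> < \<infinity>" using order.strict_trans1[OF holder[of a "max a b + 1"]] by simp
    finally show ?thesis .
  qed
  interpret N: diffuse_measure N
    unfolding N_def using finN by (intro L.diffuse_density) (auto simp: I_def)
  \<comment> \<open>The characteristic uses adjacent intervals of equal length, so both are enlarged
    about \<open>b\<close> to length \<open>c - a\<close>; the two averages account for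
    \<open>1 + m\<close> powers of that length.\<close>
  have test: "measure U {a<..b} * measure T {b<..c} powr m \<le> K * (c - a) powr (m + 1)"
    if "a < b" "b < c" for a b c
  proof -
    define h where "h = c - a"
    have h: "0 < h" using that by (simp add: h_def)
    have "(ennreal (1 / h) * I v a b) * ennpow (ennreal (1 / h) * I \<sigma> b c) m
       \<le> (ennreal (1 / h) * I v (b - h) b) * ennpow (ennreal (1 / h) * I \<sigma> b (b + h)) m"
      using that m by (intro mult_mono ennpow_mono mult_left_mono I_mono) (auto simp: h_def)
    also have "\<dots> \<le> ennreal K" by (rule char[OF h])
    finally have "ennreal ((1 / h * measure U {a<..b}) * (1 / h * measure T {b<..c}) powr m) \<le> ennreal K"
      using that h by (simp add: Tm Um ennpow_ennreal flip: ennreal_mult)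
    then have "(1 / h * measure U {a<..b}) * (1 / h * measure T {b<..c}) powr m \<le> K"
      using charK(2) by simp
    then have "h powr (m + 1) * ((1 / h * measure U {a<..b}) * (1 / h * measure T {b<..c}) powr m) \<le> h powr (m + 1) * K"
      by (rule mult_left_mono) simp
    moreover have "h powr (m + 1) * ((1 / h * measure U {a<..b}) * (1 / h * measure T {b<..c}) powr m)
        = measure U {a<..b} * measure T {b<..c} powr m"
      using h by (simp add: powr_add powr_mult powr_divide)
    ultimately show ?thesis by (simp add: h_def mult.commute)
  qed

  \<comment> \<open>Two maximal inequalities applied to the pointwise estimate\<close>
  define G where "G = max_rat T (\<lambda>y. ennreal (g y) / ennreal (\<sigma> y))"
  define \<phi> where "\<phi> = (\<lambda>y. ennpow (G y) ((p - 1) / \<beta>) / ennreal (v y))"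
  define R where "R = max_rat U \<phi>"
  define C where "C = 4 * 4 powr m / (1 - (1 / 2) powr \<beta>) powr (m / \<beta>)"
  have C0: "0 \<le> C" by (simp add: C_def)
  have "G \<in> borel_measurable T"
    unfolding G_def by (rule T.max_rat_measurable) (simp add: T_def)
  then have [measurable]: "G \<in> borel_measurable lebesgue" by (simp add: T_def)
  have [measurable]: "\<phi> \<in> borel_measurable lebesgue" unfolding \<phi>_def by measurable
  have "R \<in> borel_measurable U"
    unfolding R_def by (rule U.max_rat_measurable) (simp add: U_def)
  then have [measurable]: "R \<in> borel_measurable lebesgue" by (simp add: U_def)
  have frac: "frac_max_plus \<alpha> f = frac_max_plus (1 - \<beta>) g"
    by (simp add: frac_max_plus_def g_def \<beta>_def fun_eq_iff)
  have point: "ennpow (frac_max_plus \<alpha> f x) (m / \<beta>) \<le> R x * ennreal (C * K)" for x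
    unfolding frac R_def \<phi>_def G_def C_def U_def T_def
  proof (rule frac_max_plus_pointwise)
    show "measure (density lebesgue (\<lambda>x. ennreal (g x))) {a<..b}
        \<le> measure (density lebesgue (\<lambda>x. ennreal (\<sigma> x))) {a<..b} powr (1 / p')" if "a < b" for a b
      unfolding N_def[symmetric] T_def[symmetric]
    proof -
      have "ennreal (measure N {a<..b}) = I g a b"
        using that NI[of a b] N.emeasure_Icc[of a b] by (simp add: N.emeasure_Ioc)
      with holder[OF that] show "measure N {a<..b} \<le> measure T {a<..b} powr (1 / p')"
        by (metis ennreal_le_iff powr_ge_zero)
    qed
    show "diffuse_measure (density lebesgue (\<lambda>x. ennreal (v x)))"
      "diffuse_measure (density lebesgue (\<lambda>x. ennreal (\<sigma> x)))"
      "diffuse_measure (density lebesgue (\<lambda>x. ennreal (g x)))"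
      unfolding U_def[symmetric] T_def[symmetric] N_def[symmetric] by unfold_locales
    show "0 < measure (density lebesgue (\<lambda>x. ennreal (\<sigma> x))) {a<..b}" if "a < b" for a b
      using Tpos[OF that] by (simp add: T_def)
    show "measure (density lebesgue (\<lambda>x. ennreal (v x))) {a<..b}
        * measure (density lebesgue (\<lambda>x. ennreal (\<sigma> x))) {b<..c} powr m \<le> K * (c - a) powr (m + 1)"
      if "a < b" "b < c" for a b c
      using test[OF that] by (simp add: U_def T_def)
  qed (use vpos spos g0 charK \<beta> p m p' exps in auto)
  have "(\<integral>\<^sup>+x. ennpow (frac_max_plus \<alpha> f x) q * ennreal (v x) \<partial>lebesgue)
      \<le> (\<integral>\<^sup>+x. ennreal (v x) * (ennpow (ennreal (C * K)) s * ennpow (R x) s) \<partial>lebesgue)"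
  proof (rule nn_integral_mono)
    fix x
    have "ennpow (frac_max_plus \<alpha> f x) q = ennpow (ennpow (frac_max_plus \<alpha> f x) (m / \<beta>)) s"
      by (simp only: ennpow_ennpow s(2))
    also have "\<dots> \<le> ennpow (R x * ennreal (C * K)) s"
      using point s1 by (intro ennpow_mono) auto
    also have "\<dots> = ennpow (ennreal (C * K)) s * ennpow (R x) s"
      by (simp only: ennpow_mult mult.commute)
    finally show "ennpow (frac_max_plus \<alpha> f x) q * ennreal (v x)
        \<le> ennreal (v x) * (ennpow (ennreal (C * K)) s * ennpow (R x) s)"
      by (subst mult.commute) (rule mult_left_mono, auto)
  qed
  also have "\<dots> = (\<integral>\<^sup>+x. ennpow (ennreal (C * K)) s * ennpow (R x) s \<partial>U)"
    unfolding U_def by (rule nn_integral_density[symmetric]) measurable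
  also have "\<dots> = ennpow (ennreal (C * K)) s * (\<integral>\<^sup>+x. ennpow (R x) s \<partial>U)"
    by (rule nn_integral_cmult) (simp add: U_def)
  also have "\<dots> \<le> ennpow (ennreal (C * K)) s * (ennreal (s * 2 powr s / (s - 1)) * (\<integral>\<^sup>+x. ennpow (\<phi> x) s \<partial>U))"
    unfolding R_def using s1 by (intro mult_left_mono U.max_rat_strong_type) (auto simp: U_def)
  also have "(\<integral>\<^sup>+x. ennpow (\<phi> x) s \<partial>U) = (\<integral>\<^sup>+x. ennreal (v x) * ennpow (\<phi> x) s \<partial>lebesgue)"
    unfolding U_def by (rule nn_integral_density) measurable
  \<comment> \<open>The choice of \<open>s\<close> gives \<open>(p - 1) / \<beta> * s = p\<close>
    and \<open>v x powr (1 - s) = \<sigma> x\<close>, which changes the \<open>U\<close>-integral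
    into a \<open>T\<close>-integral of the power \<open>p\<close> of \<open>G\<close>.\<close>
  also have "\<dots> = (\<integral>\<^sup>+x. ennreal (\<sigma> x) * ennpow (G x) p \<partial>lebesgue)"
  proof (rule nn_integral_cong_AE)
    show "AE x in lebesgue. ennreal (v x) * ennpow (\<phi> x) s = ennreal (\<sigma> x) * ennpow (G x) p"
      using wpos
    proof eventually_elim
      case (elim x)
      then have v: "0 < v x" by (simp add: v_def)
      have "\<phi> x = ennpow (G x) ((p - 1) / \<beta>) * ennreal (1 / v x)"
        using v by (simp add: \<phi>_def divide_ennreal_def inverse_ennreal inverse_eq_divide)
      then have "ennpow (\<phi> x) s = ennpow (G x) ((p - 1) / \<beta> * s) * ennreal ((1 / v x) powr s)"
        using v by (simp add: ennpow_mult ennpow_ennpow ennpow_ennreal)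
      also have "(p - 1) / \<beta> * s = p" using \<beta> p'(4) by (simp add: s(3))
      finally have "ennreal (v x) * ennpow (\<phi> x) s = ennreal (v x) * ennreal ((1 / v x) powr s) * ennpow (G x) p"
        by (simp only: mult_ac)
      also have "ennreal (v x) * ennreal ((1 / v x) powr s) = ennreal (\<sigma> x)"
      proof -
        have "v x * (1 / v x) powr s = v x powr (1 - s)"
          using v by (simp add: powr_divide powr_diff)
        also have "\<dots> = w x powr (q * (1 - s))" by (simp add: v_def powr_powr)
        also have "q * (1 - s) = - p'"
        proof -
          have "1 - s = - (1 / m)" using m by (simp add: s(1) add_divide_distrib)
          then show ?thesis using q0 p'(1) by (simp add: m_def)
        qed
        finally show ?thesis using v by (simp add: \<sigma>_def flip: ennreal_mult)
      qed
      finally show ?case .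
    qed
  qed
  also have "\<dots> = (\<integral>\<^sup>+x. ennpow (G x) p \<partial>T)"
    unfolding T_def by (rule nn_integral_density[symmetric]) measurable
  also have "\<dots> \<le> ennreal (p * 2 powr p / (p - 1)) * (\<integral>\<^sup>+x. ennpow (ennreal (g x) / ennreal (\<sigma> x)) p \<partial>T)"
    unfolding G_def using p by (intro T.max_rat_strong_type) (auto simp: T_def)
  also have "(\<integral>\<^sup>+x. ennpow (ennreal (g x) / ennreal (\<sigma> x)) p \<partial>T)
      = (\<integral>\<^sup>+x. ennreal (\<sigma> x) * ennpow (ennreal (g x) / ennreal (\<sigma> x)) p \<partial>lebesgue)"
    unfolding T_def by (rule nn_integral_density) measurable
  \<comment> \<open>By \<open>(p - 1) * p' = p\<close>, the power
    \<open>\<sigma> x powr (1 - p)\<close> is \<open>w x powr p\<close>, so the original norm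
    reappears.\<close>
  also have "\<dots> = (\<integral>\<^sup>+x. ennreal (g x powr p * w x powr p) \<partial>lebesgue)"
  proof (rule nn_integral_cong_AE)
    show "AE x in lebesgue. ennreal (\<sigma> x) * ennpow (ennreal (g x) / ennreal (\<sigma> x)) p = ennreal (g x powr p * w x powr p)"
      using wpos
    proof eventually_elim
      case (elim x)
      then have \<sigma>: "0 < \<sigma> x" by (simp add: \<sigma>_def)
      have "ennreal (\<sigma> x) * ennpow (ennreal (g x) / ennreal (\<sigma> x)) p = ennreal (\<sigma> x * (g x / \<sigma> x) powr p)"
        using \<sigma> g0 by (simp add: divide_ennreal ennpow_ennreal ennreal_mult)
      also have "\<sigma> x * (g x / \<sigma> x) powr p = g x powr p * \<sigma> x powr (1 - p)"
        using \<sigma> g0 by (simp add: powr_divide powr_diff)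
      also have "\<sigma> x powr (1 - p) = w x powr p"
      proof -
        have "- p' * (1 - p) = p" using p'(4) by (simp add: algebra_simps)
        then show ?thesis by (simp only: \<sigma>_def powr_powr)
      qed
      finally show ?case .
    qed
  qed
  also have "\<dots> \<le> 1" by (rule gnorm)
  finally have "(\<integral>\<^sup>+x. ennpow (frac_max_plus \<alpha> f x) q * ennreal (v x) \<partial>lebesgue)
      \<le> ennpow (ennreal (C * K)) s * (ennreal (s * 2 powr s / (s - 1)) * (ennreal (p * 2 powr p / (p - 1)) * 1))"
    by (simp add: mult_left_mono)
  then have "wnorm q v (frac_max_plus \<alpha> f)
      \<le> ennpow (ennpow (ennreal (C * K)) s * (ennreal (s * 2 powr s / (s - 1)) * (ennreal (p * 2 powr p / (p - 1)) * 1))) (1 / q)"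
    unfolding wnorm_def using q0 by (intro ennpow_mono) auto
  also have "\<dots> = ennreal (C powr (s / q) * ((s * 2 powr s / (s - 1)) * (p * 2 powr p / (p - 1))) powr (1 / q))
      * ennpow (ennreal K) (p' / q * (1 - \<alpha>))"
  proof -
    have "ennreal (s * 2 powr s / (s - 1)) * (ennreal (p * 2 powr p / (p - 1)) * 1)
        = ennreal ((s * 2 powr s / (s - 1)) * (p * 2 powr p / (p - 1)))" (is "_ = ennreal ?B")
      using s1 p by (simp flip: ennreal_mult)
    moreover have "ennpow (ennpow (ennreal (C * K)) s * ennreal ?B) (1 / q)
        = ennreal ((C * K) powr (s / q)) * ennreal (?B powr (1 / q))"
      using s1 p charK(2) C0 by (simp add: ennpow_mult ennpow_ennpow ennpow_ennreal powr_powr)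
    moreover have "\<dots> = ennreal (C powr (s / q) * ?B powr (1 / q)) * ennreal (K powr (s / q))"
      using C0 charK(2) by (simp add: powr_mult mult_ac flip: ennreal_mult)
    moreover have "ennpow (ennreal K) (p' / q * (1 - \<alpha>)) = ennreal (K powr (s / q))"
      using charK(2) by (simp add: ennpow_ennreal s_def)
    ultimately show ?thesis by (simp only:)
  qed
  finally show ?thesis
    unfolding C_def \<beta>_def v_def charK(1) .
qed

subsection \<open>Sharpness\<close>

text \<open>Abstract, so that one argument serves both signs. The lower bound on \<open>X w\<close>
  drives the point at which \<open>\<psi>\<close> is evaluated to infinity; the upper bound
  expresses \<open>d\<close> by that point and turns \<open>d powr - \<beta>\<close> into a multiple
  of \<open>t powr \<gamma>\<close>.\<close>

lemma no_slower_rate: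
  fixes X Nm :: "'a \<Rightarrow> ennreal"
  assumes m: "0 < m" and b: "0 < \<beta>" and c: "0 < c" and \<gamma>: "\<gamma> = \<beta> / m"
    and fam: "\<And>d. 0 < d \<Longrightarrow> d < 1 \<Longrightarrow> \<exists>w\<in>S. ennreal (d powr - m / (1 + m)) \<le> X w
        \<and> X w \<le> ennreal ((6 / d) powr m) \<and> ennreal (c * d powr - \<beta>) \<le> Nm w"
  shows "\<not> (\<exists>\<psi>::real \<Rightarrow> real. (\<forall>t\<ge>1. \<psi> t > 0) \<and> mono_on {1..} \<psi>
      \<and> ((\<lambda>t. \<psi> t / t powr \<gamma>) \<longlongrightarrow> 0) at_top
      \<and> (\<forall>w \<in> S. Nm w \<le> ennreal (\<psi> (enn2real (X w)))))"
proof safe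
  fix \<psi> :: "real \<Rightarrow> real"
  assume lim: "((\<lambda>t. \<psi> t / t powr \<gamma>) \<longlongrightarrow> 0) at_top"
    and le: "\<forall>w\<in>S. Nm w \<le> ennreal (\<psi> (enn2real (X w)))"
  have "eventually (\<lambda>t. \<psi> t / t powr \<gamma> < c / 6 powr \<beta>) at_top"
    using lim c by (intro order_tendstoD(2)) auto
  then obtain B where B: "\<And>t. B \<le> t \<Longrightarrow> \<psi> t / t powr \<gamma> < c / 6 powr \<beta>"
    by (auto simp: eventually_at_top_linorder)
  \<comment> \<open>\<open>d\<close> solves \<open>d powr - m / (1 + m) = B'\<close>, which puts
    \<open>X w\<close> beyond the threshold \<open>B\<close>; the 2 ensures
    \<open>d < 1\<close>.\<close>
  define B' where "B' = max B 2"
  define d where "d = ((1 + m) * B') powr (- 1 / m)"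
  have mB: "1 < (1 + m) * B'"
  proof -
    have "1 * 1 < (1 + m) * B'"
      using m by (intro mult_strict_mono) (auto simp: B'_def)
    then show ?thesis by simp
  qed
  have d: "0 < d" "d < 1" "d powr - m = (1 + m) * B'"
    using m mB powr_less_mono[of "- 1 / m" 0 "(1 + m) * B'"]
    by (auto simp: d_def powr_powr B'_def split: if_splits)
  obtain w where w: "w \<in> S" "ennreal (d powr - m / (1 + m)) \<le> X w"
    "X w \<le> ennreal ((6 / d) powr m)" "ennreal (c * d powr - \<beta>) \<le> Nm w"
    using fam[OF d(1,2)] by blast
  define t where "t = enn2real (X w)"
  have Xw: "X w = ennreal t"
    using w(3) by (auto simp: t_def top_unique intro!: ennreal_enn2real[symmetric] order.strict_trans1[OF w(3)])
  have t: "B' \<le> t" "t \<le> (6 / d) powr m"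
  proof -
    have "d powr - m / (1 + m) = B'" using d(3) m by simp
    then show "B' \<le> t" using w(2) unfolding Xw by (simp add: t_def)
    show "t \<le> (6 / d) powr m" using w(3) unfolding Xw by (simp add: t_def)
  qed
  have t0: "0 < t" using t by (simp add: B'_def)
  have "ennreal (c * d powr - \<beta>) \<le> ennreal (\<psi> t)"
    using w(4) le w(1) unfolding t_def by (blast intro: order_trans)
  \<comment> \<open>Negative reals collapse to \<open>0\<close> in \<open>ennreal\<close>;
    positivity of the left side permits the return to real numbers.\<close>
  moreover have "0 < c * d powr - \<beta>" using c d by simp
  ultimately have 1: "c * d powr - \<beta> \<le> \<psi> t"
    by (metis ennreal_le_iff2 not_le)
  have "t powr \<gamma> \<le> ((6 / d) powr m) powr \<gamma>"
    using t t0 m b by (intro powr_mono2) (auto simp: \<gamma>)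
  also have "\<dots> = (6 / d) powr \<beta>"
    using m by (simp add: \<gamma> powr_powr)
  also have "\<dots> = 6 powr \<beta> * d powr - \<beta>"
    using d(1) by (simp add: powr_divide powr_minus_divide)
  finally have "c / 6 powr \<beta> * t powr \<gamma> \<le> c / 6 powr \<beta> * (6 powr \<beta> * d powr - \<beta>)"
    using c by (intro mult_left_mono) auto
  also have "\<dots> = c * d powr - \<beta>" by simp
  also note 1
  finally have "c / 6 powr \<beta> \<le> \<psi> t / t powr \<gamma>"
    using t0 by (simp add: pos_le_divide_eq)
  moreover have "\<psi> t / t powr \<gamma> < c / 6 powr \<beta>"
    using t by (intro B) (simp add: B'_def)
  ultimately show False by simp
qed

section \<open>Extremal power weights\<close>

lemma borel_measurable_abs_powr [measurable]: "(\<lambda>x::real. \<bar>x\<bar> powr e) \<in> borel_measurable lebesgue"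
  by (intro measurable_completion) simp

lemma nn_integral_abs_powr:
  assumes "- 1 < e" "0 \<le> c"
  shows "(\<integral>\<^sup>+x\<in>{0..c}. ennreal (\<bar>x\<bar> powr e) \<partial>lebesgue) = ennreal (c powr (e + 1) / (e + 1))"
    and "(\<integral>\<^sup>+x\<in>{-c..0}. ennreal (\<bar>x\<bar> powr e) \<partial>lebesgue) = ennreal (c powr (e + 1) / (e + 1))"
proof -
  have "((\<lambda>x. x powr e) has_integral (c powr (e + 1) / (e + 1))) {0..c}"
    using assms by (rule has_integral_powr_from_0)
  then have 1: "((\<lambda>x. \<bar>x\<bar> powr e) has_integral (c powr (e + 1) / (e + 1))) {0..c}"
    by (rule has_integral_eq[rotated]) auto
  then have "((\<lambda>x. \<bar>- x\<bar> powr e) has_integral (c powr (e + 1) / (e + 1))) {- c..- 0}"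
    by (subst has_integral_reflect_real)
  then have 2: "((\<lambda>x. \<bar>x\<bar> powr e) has_integral (c powr (e + 1) / (e + 1))) {- c..0}"
    by simp
  show "(\<integral>\<^sup>+x\<in>{0..c}. ennreal (\<bar>x\<bar> powr e) \<partial>lebesgue) = ennreal (c powr (e + 1) / (e + 1))"
    unfolding nn_integral_completion using 1 by (intro nn_integral_has_integral_lebesgue') auto
  show "(\<integral>\<^sup>+x\<in>{-c..0}. ennreal (\<bar>x\<bar> powr e) \<partial>lebesgue) = ennreal (c powr (e + 1) / (e + 1))"
    unfolding nn_integral_completion using 2 by (intro nn_integral_has_integral_lebesgue') auto
qed

lemma average_le:
  assumes "\<And>t. t \<in> {a..b} \<Longrightarrow> u t \<le> c" "0 \<le> c" "b - a = h" "0 < h"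
  shows "ennreal (1 / h) * (\<integral>\<^sup>+t\<in>{a..b}. ennreal (u t) \<partial>lebesgue) \<le> ennreal c"
proof -
  have "(\<integral>\<^sup>+t\<in>{a..b}. ennreal (u t) \<partial>lebesgue) \<le> (\<integral>\<^sup>+t. ennreal c * indicator {a..b} t \<partial>lebesgue)"
    using assms by (intro nn_integral_mono) (auto split: split_indicator intro!: ennreal_leI)
  also have "\<dots> = ennreal c * emeasure lebesgue {a..b}"
    by (rule nn_integral_cmult_indicator) simp
  also have "\<dots> = ennreal (c * h)"
    using assms by (simp add: ennreal_mult)
  finally have "ennreal (1 / h) * (\<integral>\<^sup>+t\<in>{a..b}. ennreal (u t) \<partial>lebesgue) \<le> ennreal (1 / h) * ennreal (c * h)"
    by (rule mult_left_mono) simp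
  also have "\<dots> = ennreal c" using assms by (simp flip: ennreal_mult)
  finally show ?thesis .
qed

text \<open>The weight is \<open>\<bar>x\<bar>\<close> to the power \<open>(1 - d) / p'\<close>, and the test function is a multiple of \<open>\<bar>x\<bar>\<close> to the
  power \<open>d - 1\<close> on \<open>(0, 1)\<close>.\<close>

lemma power_weight_extremal:
  fixes \<alpha> p q d :: real
  defines "m \<equiv> q / conj_exp p"
  assumes \<alpha>: "0 < \<alpha>" "\<alpha> < 1" and p: "1 < p" "p < 1 / \<alpha>" and q: "1 / p - 1 / q - \<alpha> = 0"
    and d: "0 < d" "d < 1"
  shows "\<exists>w\<in>Apq_plus p q. ennreal (d powr - m / (1 + m)) \<le> Apq_plus_char p q w
    \<and> Apq_plus_char p q w \<le> ennreal ((6 / d) powr m)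
    \<and> ennreal (2 powr - (1 - \<alpha>) * (p / q) powr (1 / q) * d powr - (1 - \<alpha>))
       \<le> op_norm p (\<lambda>x. w x powr p) q (\<lambda>x. w x powr q) (frac_max_plus \<alpha>)"
proof -
  define p' where "p' = conj_exp p"
  define \<beta> where "\<beta> = 1 - \<alpha>"
  have p': "1 < p'" "p' = p / (p - 1)" "1 / p' = 1 - 1 / p"
    using p by (auto simp: p'_def conj_exp_def field_simps)
  have iq: "1 / q = 1 / p - \<alpha>" using q by simp
  have "\<alpha> < 1 / p" using p \<alpha> by (simp add: field_simps)
  then have q0: "0 < q" using iq by (metis diff_gt_0_iff_gt zero_less_divide_1_iff)
  have m: "0 < m" and mq: "m = q / p'" using q0 p'(1) by (simp_all add: m_def flip: p'_def)
  have qb: "q * \<beta> = m + 1"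
  proof -
    have "\<beta> = 1 / q + 1 / p'" using iq p'(3) by (simp add: \<beta>_def)
    then show ?thesis using q0 by (simp add: mq distrib_left)
  qed
  define w where "w = (\<lambda>x::real. \<bar>x\<bar> powr ((1 - d) / p'))"
  \<comment> \<open>As \<open>d\<close> tends to 0, \<open>w powr q\<close> stays bounded near the
    origin, while the dual weight \<open>w powr - p'\<close> approaches the non-integrable
    \<open>1 / |x|\<close>, with mass of order \<open>1 / d\<close>; the power \<open>m\<close> of
    this mass gives the size of the characteristic.\<close>
  have wq: "w x powr q = \<bar>x\<bar> powr ((1 - d) * m)" for x
    by (simp add: w_def powr_powr mq)
  have ws: "w x powr - p' = \<bar>x\<bar> powr (d - 1)" for x
    using p'(1) by (simp add: w_def powr_powr)
  have "weight w"
    unfolding weight_def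
  proof (intro conjI allI)
    show "w \<in> borel_measurable lebesgue" unfolding w_def by (rule borel_measurable_abs_powr)
    have "AE x in lebesgue. x \<noteq> (0::real)"
      using AE_lborel_singleton[of "0::real"] by (intro AE_completion)
    then show "AE x in lebesgue. 0 < w x" by eventually_elim (simp add: w_def)
    have "0 < (1 - d) / p'" using d p'(1) by simp
    then have "continuous_on {a..b} w" for a b
      unfolding w_def by (intro continuous_on_powr' continuous_intros) auto
    then show "set_integrable lebesgue {a..b} w" for a b
      by (rule absolutely_integrable_continuous_real)
  qed
  define A where "A = (\<lambda>x h. (ennreal (1 / h) * (\<integral>\<^sup>+t\<in>{x-h..x}. ennreal (\<bar>t\<bar> powr ((1 - d) * m)) \<partial>lebesgue))
     * ennpow (ennreal (1 / h) * (\<integral>\<^sup>+t\<in>{x..x+h}. ennreal (\<bar>t\<bar> powr (d - 1)) \<partial>lebesgue)) m)"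
  have char: "Apq_plus_char p q w = (SUP x. SUP h \<in> {0<..}. A x h)"
    unfolding Apq_plus_char_def A_def wq p'_def[symmetric] ws mq[symmetric] ..
  have lower: "ennreal (d powr - m / (1 + m)) \<le> Apq_plus_char p q w"
  proof -
    have "d powr - m / (1 + m) \<le> 1 / ((1 - d) * m + 1) * (1 / d) powr m"
    proof -
      have "(1 - d) * m \<le> 1 * m" using d m by (intro mult_right_mono) auto
      then have "1 / (1 + m) \<le> 1 / ((1 - d) * m + 1)"
        using d m by (intro divide_left_mono mult_pos_pos add_nonneg_pos mult_nonneg_nonneg) auto
      then have "(1 / (1 + m)) * d powr - m \<le> 1 / ((1 - d) * m + 1) * d powr - m"
        by (rule mult_right_mono) simp
      moreover have "(1 / d) powr m = d powr - m"
        using d by (simp add: powr_divide powr_minus_divide)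
      ultimately show ?thesis by simp
    qed
    then have "ennreal (d powr - m / (1 + m)) \<le> ennreal (1 / ((1 - d) * m + 1) * (1 / d) powr m)"
      by (rule ennreal_leI)
    also have "\<dots> = ennreal (1 / ((1 - d) * m + 1)) * ennreal ((1 / d) powr m)"
      using d m by (intro ennreal_mult divide_nonneg_nonneg add_nonneg_nonneg mult_nonneg_nonneg) auto
    \<comment> \<open>The unit intervals on both sides of the origin; the right one has dual mass
      \<open>1 / d\<close>.\<close>
    also have "\<dots> = A 0 1"
      using nn_integral_abs_powr(2)[of "(1 - d) * m" 1] nn_integral_abs_powr(1)[of "d - 1" 1] d m
      by (simp add: A_def ennpow_ennreal order_less_le_trans[of "-1" 0])
    also have "\<dots> \<le> Apq_plus_char p q w"
      unfolding char by (intro SUP_upper2[of 0] SUP_upper2[of 1]) auto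
    finally show ?thesis .
  qed
  have upper: "Apq_plus_char p q w \<le> ennreal ((6 / d) powr m)"
    unfolding char
  proof (intro SUP_least)
    fix x h :: real assume "h \<in> {0<..}"
    then have h: "0 < h" by simp
    show "A x h \<le> ennreal ((6 / d) powr m)"
    \<comment> \<open>Near the origin both intervals lie in \<open>{- (3 * h)..3 * h}\<close>, whose
      dual mass \<open>2 * (3 * h) powr d / d\<close> is the source of \<open>6 / d\<close>.
      Otherwise \<open>|t|\<close> stays between \<open>|x| / 2\<close> and \<open>2 * |x|\<close>,
      and the powers of \<open>|x|\<close> cancel.\<close>
    proof (cases "\<bar>x\<bar> \<le> 2 * h")
      case True
      have 1: "ennreal (1 / h) * (\<integral>\<^sup>+t\<in>{x-h..x}. ennreal (\<bar>t\<bar> powr ((1 - d) * m)) \<partial>lebesgue)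
          \<le> ennreal ((3 * h) powr ((1 - d) * m))"
        using True h d m by (intro average_le powr_mono2) auto
      have "(\<integral>\<^sup>+t\<in>{x..x+h}. ennreal (\<bar>t\<bar> powr (d - 1)) \<partial>lebesgue)
          \<le> (\<integral>\<^sup>+t. ennreal (\<bar>t\<bar> powr (d - 1)) * indicator {0..3 * h} t
                + ennreal (\<bar>t\<bar> powr (d - 1)) * indicator {- (3 * h)..0} t \<partial>lebesgue)"
        using True h by (intro nn_integral_mono) (auto split: split_indicator)
      also have "\<dots> = ennreal ((3 * h) powr d / d) + ennreal ((3 * h) powr d / d)"
      proof -
        have [measurable]: "{a..b} \<in> sets lebesgue" for a b :: real by simp
        show ?thesis
          using d h nn_integral_abs_powr[of "d - 1" "3 * h"] by (subst nn_integral_add) auto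
      qed
      also have "\<dots> = ennreal (2 * (3 * h) powr d / d)"
        using d by (simp flip: ennreal_plus)
      finally have "ennreal (1 / h) * (\<integral>\<^sup>+t\<in>{x..x+h}. ennreal (\<bar>t\<bar> powr (d - 1)) \<partial>lebesgue)
          \<le> ennreal (1 / h) * ennreal (2 * (3 * h) powr d / d)"
        by (rule mult_left_mono) simp
      also have "\<dots> = ennreal (1 / h * (2 * (3 * h) powr d / d))"
        using h d by (intro ennreal_mult[symmetric]) auto
      finally have 2: "ennreal (1 / h) * (\<integral>\<^sup>+t\<in>{x..x+h}. ennreal (\<bar>t\<bar> powr (d - 1)) \<partial>lebesgue)
          \<le> ennreal (1 / h * (2 * (3 * h) powr d / d))" .
      have "A x h \<le> ennreal ((3 * h) powr ((1 - d) * m)) * ennpow (ennreal (1 / h * (2 * (3 * h) powr d / d))) m"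
        unfolding A_def using 1 2 m by (intro mult_mono ennpow_mono) auto
      also have "\<dots> = ennreal ((3 * h) powr ((1 - d) * m) * (1 / h * (2 * (3 * h) powr d / d)) powr m)"
        using h d by (simp add: ennpow_ennreal ennreal_mult)
      also have "(3 * h) powr ((1 - d) * m) * (1 / h * (2 * (3 * h) powr d / d)) powr m
          = ((3 * h) powr (1 - d) * (1 / h * (2 * (3 * h) powr d / d))) powr m"
        by (simp only: powr_mult powr_powr)
      also have "(3 * h) powr (1 - d) * (1 / h * (2 * (3 * h) powr d / d)) = 6 / d"
        using h d by (simp add: powr_diff)
      finally show ?thesis .
    next
      case False
      have 1: "ennreal (1 / h) * (\<integral>\<^sup>+t\<in>{x-h..x}. ennreal (\<bar>t\<bar> powr ((1 - d) * m)) \<partial>lebesgue)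
          \<le> ennreal ((2 * \<bar>x\<bar>) powr ((1 - d) * m))"
        using False h d m by (intro average_le powr_mono2) auto
      have 2: "ennreal (1 / h) * (\<integral>\<^sup>+t\<in>{x..x+h}. ennreal (\<bar>t\<bar> powr (d - 1)) \<partial>lebesgue)
          \<le> ennreal ((\<bar>x\<bar> / 2) powr (d - 1))"
        using False h d m by (intro average_le powr_mono2') auto
      have "A x h \<le> ennreal ((2 * \<bar>x\<bar>) powr ((1 - d) * m)) * ennpow (ennreal ((\<bar>x\<bar> / 2) powr (d - 1))) m"
        unfolding A_def using 1 2 m by (intro mult_mono ennpow_mono) auto
      also have "\<dots> = ennreal ((2 * \<bar>x\<bar>) powr ((1 - d) * m) * ((\<bar>x\<bar> / 2) powr (d - 1)) powr m)"
        by (simp add: ennpow_ennreal ennreal_mult)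
      also have "(2 * \<bar>x\<bar>) powr ((1 - d) * m) * ((\<bar>x\<bar> / 2) powr (d - 1)) powr m
          = ((2 * \<bar>x\<bar>) powr (1 - d) * (\<bar>x\<bar> / 2) powr (d - 1)) powr m"
        by (simp only: powr_mult powr_powr)
      also have "(2 * \<bar>x\<bar>) powr (1 - d) * (\<bar>x\<bar> / 2) powr (d - 1) = 4 powr (1 - d)"
      proof -
        have x: "0 < \<bar>x\<bar>" using False h by linarith
        have "(2 * \<bar>x\<bar>) powr (1 - d) = 4 powr (1 - d) * (\<bar>x\<bar> / 2) powr (1 - d)"
          using powr_mult[of 4 "\<bar>x\<bar> / 2" "1 - d"] by simp
        moreover have "(\<bar>x\<bar> / 2) powr (1 - d) * (\<bar>x\<bar> / 2) powr (d - 1) = 1"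
          using x by (simp flip: powr_add)
        ultimately show ?thesis by simp
      qed
      also have "ennreal ((4 powr (1 - d)) powr m) \<le> ennreal ((6 / d) powr m)"
      proof (intro ennreal_leI powr_mono2)
        have "4 powr (1 - d) \<le> (4::real) powr 1" using d by (intro powr_mono) auto
        also have "\<dots> \<le> 6 / d" using d by (simp add: field_simps)
        finally show "4 powr (1 - d) \<le> 6 / d" .
      qed (use m in auto)
      finally show ?thesis .
    qed
  qed
  have w: "w \<in> Apq_plus p q"
    unfolding Apq_plus_def using \<open>weight w\<close> order.strict_trans1[OF upper] by simp

  \<comment> \<open>Test function and lower bound for the norm\<close>
  define f where "f = (\<lambda>x::real. d powr (1 / p) * \<bar>x\<bar> powr (d - 1) * indicator {0..1} x)"
  have [measurable]: "{a..b} \<in> sets lebesgue" for a b :: real by simp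
  have f_meas [measurable]: "f \<in> borel_measurable lebesgue"
    unfolding f_def by measurable
  \<comment> \<open>On \<open>{0..1}\<close> the function is a multiple of
    \<open>w powr - p'\<close>, the equality case of Hoelder's inequality;
    \<open>d powr (1 / p)\<close> normalizes it.\<close>
  have f_norm: "wnorm p (\<lambda>x. w x powr p) (\<lambda>x. ennreal \<bar>f x\<bar>) \<le> 1"
  proof -
    have "ennpow (ennreal \<bar>f x\<bar>) p * ennreal (w x powr p)
        = ennreal d * (ennreal (\<bar>x\<bar> powr (d - 1)) * indicator {0..1} x)" for x
    proof (cases "x \<in> {0..1}")
      case True
      have "(1 - d) / p' * p = (1 - d) * (p - 1)" using p by (simp add: p'(2))
      then have e: "(d - 1) * p + (1 - d) / p' * p = d - 1" by (simp add: algebra_simps)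
      have "\<bar>f x\<bar> powr p * w x powr p = d * (\<bar>x\<bar> powr ((d - 1) * p) * \<bar>x\<bar> powr ((1 - d) / p' * p))"
        using True d p by (simp add: f_def w_def powr_mult powr_powr abs_mult)
      also have "\<dots> = d * \<bar>x\<bar> powr (d - 1)"
        by (simp only: powr_add[symmetric] e)
      finally show ?thesis
        using True d by (simp add: ennpow_ennreal flip: ennreal_mult)
    qed (simp add: f_def)
    then have "wnorm p (\<lambda>x. w x powr p) (\<lambda>x. ennreal \<bar>f x\<bar>)
        = ennpow (ennreal d * (\<integral>\<^sup>+x\<in>{0..1}. ennreal (\<bar>x\<bar> powr (d - 1)) \<partial>lebesgue)) (1 / p)"
      unfolding wnorm_def by (simp add: nn_integral_cmult)
    also have "\<dots> = 1"
      using nn_integral_abs_powr(1)[of "d - 1" 1] d by (simp flip: ennreal_mult)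
    finally show ?thesis by simp
  qed
  define c where "c = 2 powr - \<beta> * d powr (1 / p - 1)"
  have c: "0 < c" using d by (simp add: c_def)
  \<comment> \<open>A window of length \<open>2 * |x|\<close> reaches from \<open>x\<close> across
    the origin to \<open>|x|\<close> and catches the concentrated mass
    \<open>d powr (1 / p) * (|x| powr d / d)\<close>. Its length is the source of
    \<open>2 powr - \<beta>\<close>.\<close>
  have mf: "ennreal (c * \<bar>x\<bar> powr (d - \<beta>)) \<le> frac_max_plus \<alpha> f x" if x: "-1 \<le> x" "x < 0" for x
  proof -
    have "ennreal (d powr (1 / p) * (\<bar>x\<bar> powr d / d))
        = ennreal (d powr (1 / p)) * (\<integral>\<^sup>+t\<in>{0..\<bar>x\<bar>}. ennreal (\<bar>t\<bar> powr (d - 1)) \<partial>lebesgue)"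
      using nn_integral_abs_powr(1)[of "d - 1" "\<bar>x\<bar>"] d
        ennreal_mult[of "d powr (1 / p)" "\<bar>x\<bar> powr d / d"] by simp
    also have "\<dots> = (\<integral>\<^sup>+t. ennreal (d powr (1 / p)) * (ennreal (\<bar>t\<bar> powr (d - 1)) * indicator {0..\<bar>x\<bar>} t) \<partial>lebesgue)"
      by (rule nn_integral_cmult[symmetric]) measurable
    also have "\<dots> \<le> (\<integral>\<^sup>+t\<in>{x..x + 2 * \<bar>x\<bar>}. ennreal \<bar>f t\<bar> \<partial>lebesgue)"
      using x by (intro nn_integral_mono) (auto simp: f_def ennreal_mult split: split_indicator)
    finally have "ennreal (1 / (2 * \<bar>x\<bar>) powr (1 - \<alpha>)) * ennreal (d powr (1 / p) * (\<bar>x\<bar> powr d / d))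
        \<le> ennreal (1 / (2 * \<bar>x\<bar>) powr (1 - \<alpha>)) * (\<integral>\<^sup>+t\<in>{x..x + 2 * \<bar>x\<bar>}. ennreal \<bar>f t\<bar> \<partial>lebesgue)"
      by (rule mult_left_mono) simp
    also have "\<dots> \<le> frac_max_plus \<alpha> f x"
      unfolding frac_max_plus_def using x by (intro SUP_upper) auto
    finally have "ennreal (1 / (2 * \<bar>x\<bar>) powr (1 - \<alpha>) * (d powr (1 / p) * (\<bar>x\<bar> powr d / d))) \<le> frac_max_plus \<alpha> f x"
      using d by (subst ennreal_mult) auto
    also have "1 / (2 * \<bar>x\<bar>) powr (1 - \<alpha>) * (d powr (1 / p) * (\<bar>x\<bar> powr d / d)) = c * \<bar>x\<bar> powr (d - \<beta>)"
    proof -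
      have "(2 * \<bar>x\<bar>) powr \<beta> = 2 powr \<beta> * \<bar>x\<bar> powr \<beta>" by (rule powr_mult)
      then show ?thesis
        using d unfolding \<beta>_def[symmetric] c_def powr_diff powr_minus by (simp add: field_simps)
    qed
    finally show ?thesis .
  qed
  \<comment> \<open>The lower bound for the weighted integrand on the left of the origin is a
    multiple of \<open>|x| powr (e - 1)\<close>, with integral \<open>1 / e\<close> of order
    \<open>1 / d\<close>. The resulting \<open>d powr (- 1 / q)\<close> combines with
    \<open>d powr (1 / p - 1)\<close> in \<open>c\<close> to
    \<open>d powr - \<beta>\<close>.\<close>
  define e where "e = d * (q / p)"
  have e: "0 < e" "(d - \<beta>) * q + (1 - d) * m = e - 1"
  proof -
    show "0 < e" using d q0 p by (simp add: e_def)
    have "q - m = q * (1 - 1 / p')" by (simp add: mq algebra_simps)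
    also have "\<dots> = q / p" using p'(3) by simp
    finally have qpm: "q / p = q - m" ..
    show "(d - \<beta>) * q + (1 - d) * m = e - 1"
      using qb unfolding e_def qpm by (simp add: algebra_simps)
  qed
  have "ennreal (c powr q * (1 / e)) = ennreal (c powr q) * (\<integral>\<^sup>+x\<in>{-1..0}. ennreal (\<bar>x\<bar> powr (e - 1)) \<partial>lebesgue)"
    using nn_integral_abs_powr(2)[of "e - 1" 1] e(1) by (simp flip: ennreal_mult)
  also have "\<dots> = (\<integral>\<^sup>+x. ennreal (c powr q) * (ennreal (\<bar>x\<bar> powr (e - 1)) * indicator {-1..0} x) \<partial>lebesgue)"
    by (rule nn_integral_cmult[symmetric]) measurable
  also have "\<dots> \<le> (\<integral>\<^sup>+x. ennpow (frac_max_plus \<alpha> f x) q * ennreal (w x powr q) \<partial>lebesgue)"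
  proof (rule nn_integral_mono)
    fix x :: real
    show "ennreal (c powr q) * (ennreal (\<bar>x\<bar> powr (e - 1)) * indicator {-1..0} x)
        \<le> ennpow (frac_max_plus \<alpha> f x) q * ennreal (w x powr q)"
    proof (cases "-1 \<le> x \<and> x < 0")
      case True
      have "c powr q * \<bar>x\<bar> powr (e - 1) = (c * \<bar>x\<bar> powr (d - \<beta>)) powr q * w x powr q"
        unfolding wq e(2)[symmetric] powr_add by (simp add: powr_mult powr_powr)
      then have "ennreal (c powr q) * (ennreal (\<bar>x\<bar> powr (e - 1)) * indicator {-1..0} x)
          = ennpow (ennreal (c * \<bar>x\<bar> powr (d - \<beta>))) q * ennreal (w x powr q)"
        using True c by (simp add: ennpow_ennreal flip: ennreal_mult)
      also have "\<dots> \<le> ennpow (frac_max_plus \<alpha> f x) q * ennreal (w x powr q)"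
        using mf[of x] True q0 by (intro mult_right_mono ennpow_mono) auto
      finally show ?thesis .
    next
      case False
      then have "x = 0 \<or> x \<notin> {-1..0}" by auto
      then show ?thesis by auto
    qed
  qed
  finally have "ennpow (ennreal (c powr q * (1 / e))) (1 / q) \<le> wnorm q (\<lambda>x. w x powr q) (frac_max_plus \<alpha> f)"
    unfolding wnorm_def using q0 by (intro ennpow_mono) auto
  also have "\<dots> \<le> op_norm p (\<lambda>x. w x powr p) q (\<lambda>x. w x powr q) (frac_max_plus \<alpha>)"
    unfolding op_norm_def using f_meas f_norm by (intro SUP_upper) auto
  also have "ennpow (ennreal (c powr q * (1 / e))) (1 / q) = ennreal (2 powr - \<beta> * (p / q) powr (1 / q) * d powr - \<beta>)"
  proof -
    have "1 / e = p / q * d powr - 1"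
      using d by (simp add: e_def powr_minus_divide)
    moreover have "(c powr q) powr (1 / q) = c"
      using c q0 by (simp add: powr_powr)
    ultimately have "(c powr q * (1 / e)) powr (1 / q) = c * (p / q * d powr - 1) powr (1 / q)"
      by (simp only: powr_mult)
    also have "\<dots> = c * ((p / q) powr (1 / q) * d powr (- 1 / q))"
      by (simp only: powr_mult powr_powr) simp
    also have "\<dots> = 2 powr - \<beta> * (p / q) powr (1 / q) * (d powr (1 / p - 1) * d powr (- 1 / q))"
      by (simp add: c_def)
    also have "d powr (1 / p - 1) * d powr (- 1 / q) = d powr - \<beta>"
    proof -
      have "1 / p - 1 + - 1 / q = - \<beta>" using iq by (simp add: \<beta>_def)
      then show ?thesis by (simp only: powr_add[symmetric])
    qed
    finally show ?thesis using e c by (simp add: ennpow_ennreal)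
  qed
  finally show ?thesis
    using w lower upper unfolding \<beta>_def by blast
qed

subsection \<open>Reflection\<close>

lemma measurable_uminus_lebesgue [measurable]: "uminus \<in> measurable lebesgue (lebesgue :: real measure)"
proof -
  have "(\<lambda>x::real. (-1) *\<^sub>R x) \<in> measurable lebesgue lebesgue"
    by (rule lebesgue_measurable_scaling)
  then show ?thesis by simp
qed

text \<open>Stated without measurability, because measurability of the maximal functions is not available.\<close>

lemma nn_integral_reflect:
  fixes f :: "real \<Rightarrow> ennreal"
  shows "(\<integral>\<^sup>+x. f (- x) \<partial>lebesgue) = (\<integral>\<^sup>+x. f x \<partial>lebesgue)"
proof -
  \<comment> \<open>The integral is a supremum over simple functions below \<open>f\<close>, and
    these are measurable whatever \<open>f\<close> is. Reflecting them gives one inequality; the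
    reflected \<open>f\<close> gives the other.\<close>
  have le: "(\<integral>\<^sup>+x. f x \<partial>lebesgue) \<le> (\<integral>\<^sup>+x. f (- x) \<partial>lebesgue)" for f :: "real \<Rightarrow> ennreal"
  proof (subst nn_integral_def, rule SUP_least)
    fix g assume "g \<in> {g. simple_function (lebesgue :: real measure) g \<and> g \<le> f}"
    then have g: "simple_function lebesgue g" "g \<le> f" by auto
    have "integral\<^sup>S lebesgue g = (\<integral>\<^sup>+x. g x \<partial>lebesgue)"
      using g(1) by (rule nn_integral_eq_simple_integral[symmetric])
    also have "\<dots> = (\<integral>\<^sup>+x. g (- x) \<partial>lebesgue)"
      using nn_integral_real_affine_lebesgue[of g "- 1" 0] borel_measurable_simple_function[OF g(1)]
      by simp
    also have "\<dots> \<le> (\<integral>\<^sup>+x. f (- x) \<partial>lebesgue)"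
      using g(2) by (intro nn_integral_mono) (simp add: le_fun_def)
    finally show "integral\<^sup>S lebesgue g \<le> (\<integral>\<^sup>+x. f (- x) \<partial>lebesgue)" .
  qed
  from le[of f] le[of "\<lambda>x. f (- x)"] show ?thesis by simp
qed

lemma set_nn_integral_reflect:
  "(\<integral>\<^sup>+x\<in>{a..b}. f (- x) \<partial>lebesgue) = (\<integral>\<^sup>+x\<in>{- b..- a::real}. f x \<partial>lebesgue)"
proof -
  have "(\<integral>\<^sup>+x\<in>{a..b}. f (- x) \<partial>lebesgue) = (\<integral>\<^sup>+x. f (- x) * indicator {- b..- a} (- x) \<partial>lebesgue)"
    by (intro nn_integral_cong) (auto split: split_indicator)
  also have "\<dots> = (\<integral>\<^sup>+x\<in>{- b..- a::real}. f x \<partial>lebesgue)"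
    by (rule nn_integral_reflect)
  finally show ?thesis .
qed

lemma frac_max_minus_reflect: "frac_max_minus \<alpha> (\<lambda>t. f (- t)) x = frac_max_plus \<alpha> f (- x)"
  unfolding frac_max_minus_def frac_max_plus_def
  by (simp add: set_nn_integral_reflect[where f = "\<lambda>t. ennreal \<bar>f t\<bar>"])

lemma wnorm_reflect: "wnorm r (\<lambda>x. u (- x)) (\<lambda>x. F (- x)) = wnorm r u F"
  unfolding wnorm_def by (subst nn_integral_reflect) simp

lemma Apq_minus_char_reflect: "Apq_minus_char p q (\<lambda>x. w (- x)) = Apq_plus_char p q w"
proof -
  have S: "(SUP x. g (- x)) = (SUP x. g x)" for g :: "real \<Rightarrow> ennreal"
  proof -
    have "range (\<lambda>x. g (- x)) = range g"
      by (auto simp: image_iff) (metis minus_minus)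
    then show ?thesis by simp
  qed
  have "Apq_minus_char p q (\<lambda>x. w (- x)) = (SUP x. SUP h \<in> {0<..}.
     (ennreal (1 / h) * (\<integral>\<^sup>+t\<in>{(- x) - h..- x}. ennreal (w t powr q) \<partial>lebesgue)) *
     ennpow (ennreal (1 / h) * (\<integral>\<^sup>+t\<in>{- x..(- x) + h}. ennreal (w t powr (- conj_exp p)) \<partial>lebesgue))
       (q / conj_exp p))"
    unfolding Apq_minus_char_def
    by (simp add: set_nn_integral_reflect[where f = "\<lambda>t. ennreal (w t powr q)"]
        set_nn_integral_reflect[where f = "\<lambda>t. ennreal (w t powr (- conj_exp p))"])
  also have "\<dots> = Apq_plus_char p q w"
    unfolding Apq_plus_char_def by (rule S)
  finally show ?thesis .
qed

lemma weight_reflect: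
  assumes "weight w"
  shows "weight (\<lambda>x. w (- x))"
  unfolding weight_def
proof (intro conjI allI)
  have w: "w \<in> borel_measurable lebesgue" "AE x in lebesgue. 0 < w x"
    "\<And>a b. set_integrable lebesgue {a..b} w"
    using assms by (auto simp: weight_def)
  show m: "(\<lambda>x. w (- x)) \<in> borel_measurable lebesgue"
    using measurable_uminus_lebesgue w(1) by (rule measurable_compose)
  show "AE x in lebesgue. 0 < w (- x)"
  proof -
    \<comment> \<open>Nullity of the exceptional set is read off the integral of its indicator,
      which reflection preserves.\<close>
    have S: "{x. \<not> 0 < w x} \<in> sets lebesgue" "{x. \<not> 0 < w (- x)} \<in> sets lebesgue"
      using w(1) m by (simp_all add: not_less borel_measurable_iff_le)
    have "(\<integral>\<^sup>+x. indicator {x. \<not> 0 < w x} x \<partial>lebesgue) = 0"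
      using w(2) S(1) by (subst nn_integral_indicator) (auto simp: AE_iff_measurable[OF S(1)])
    then have "(\<integral>\<^sup>+x. indicator {x. \<not> 0 < w x} (- x) \<partial>lebesgue) = 0"
      by (subst nn_integral_reflect)
    then have "(\<integral>\<^sup>+x. indicator {x. \<not> 0 < w (- x)} x \<partial>lebesgue) = 0"
      by (simp add: indicator_def)
    then show ?thesis
      using S(2) by (simp add: AE_iff_measurable[OF S(2)])
  qed
  show "set_integrable lebesgue {a..b} (\<lambda>x. w (- x))" for a b
  proof -
    have "(\<integral>\<^sup>+x. ennreal (norm (indicator {- b..- a} x *\<^sub>R w x)) \<partial>lebesgue) < \<infinity>"
      using w(3)[of "- b" "- a"] unfolding set_integrable_def integrable_iff_bounded by blast
    then have "(\<integral>\<^sup>+x. ennreal (norm (indicator {- b..- a} (- x) *\<^sub>R w (- x))) \<partial>lebesgue) < \<infinity>"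
      by (subst nn_integral_reflect[where f = "\<lambda>x. ennreal (norm (indicator {- b..- a} x *\<^sub>R w x))"])
    moreover have "indicator {- b..- a} (- x) = (indicator {a..b} x :: real)" for x
      by (auto split: split_indicator)
    moreover have "(\<lambda>x. indicator {a..b} x *\<^sub>R w (- x)) \<in> borel_measurable lebesgue"
      using m by (intro borel_measurable_scaleR borel_measurable_indicator) auto
    ultimately show ?thesis
      unfolding set_integrable_def integrable_iff_bounded by simp
  qed
qed

lemma Apq_minus_reflect_iff: "(\<lambda>x. w (- x)) \<in> Apq_minus p q \<longleftrightarrow> w \<in> Apq_plus p q"
  using weight_reflect[of w] weight_reflect[of "\<lambda>x. w (- x)"]
  by (auto simp: Apq_plus_def Apq_minus_def Apq_minus_char_reflect)

text \<open>Reflection maps one unit ball onto the other and intertwines the two maximal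
  operators.\<close>

lemma op_norm_minus_reflect:
  "op_norm p (\<lambda>x. u (- x)) q (\<lambda>x. v (- x)) (frac_max_minus \<alpha>) = op_norm p u q v (frac_max_plus \<alpha>)"
proof -
  have w: "wnorm q (\<lambda>x. v (- x)) (frac_max_minus \<alpha> (\<lambda>x. f (- x))) = wnorm q v (frac_max_plus \<alpha> f)" for f
  proof -
    have "frac_max_minus \<alpha> (\<lambda>x. f (- x)) = (\<lambda>x. frac_max_plus \<alpha> f (- x))"
      by (rule ext) (rule frac_max_minus_reflect)
    then show ?thesis by (simp only: wnorm_reflect)
  qed
  have n: "wnorm p (\<lambda>x. u (- x)) (\<lambda>x. ennreal \<bar>f (- x)\<bar>) = wnorm p u (\<lambda>x. ennreal \<bar>f x\<bar>)" for f
    by (rule wnorm_reflect)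
  have m: "(\<lambda>x. f (- x)) \<in> borel_measurable lebesgue" if "f \<in> borel_measurable lebesgue" for f :: "real \<Rightarrow> real"
    using measurable_uminus_lebesgue that by (rule measurable_compose)
  show ?thesis
    unfolding op_norm_def
  proof (rule antisym; rule SUP_least)
    fix f assume "f \<in> {f \<in> borel_measurable lebesgue. wnorm p (\<lambda>x. u (- x)) (\<lambda>x. ennreal \<bar>f x\<bar>) \<le> 1}"
    then have "(\<lambda>x. f (- x)) \<in> {f \<in> borel_measurable lebesgue. wnorm p u (\<lambda>x. ennreal \<bar>f x\<bar>) \<le> 1}"
      using n[of "\<lambda>x. f (- x)"] by (auto intro: m)
    then show "wnorm q (\<lambda>x. v (- x)) (frac_max_minus \<alpha> f)
        \<le> (SUP f\<in>{f \<in> borel_measurable lebesgue. wnorm p u (\<lambda>x. ennreal \<bar>f x\<bar>) \<le> 1}. wnorm q v (frac_max_plus \<alpha> f))"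
      using w[of "\<lambda>x. f (- x)"] by (intro SUP_upper2) auto
  next
    fix f assume "f \<in> {f \<in> borel_measurable lebesgue. wnorm p u (\<lambda>x. ennreal \<bar>f x\<bar>) \<le> 1}"
    then have "(\<lambda>x. f (- x)) \<in> {f \<in> borel_measurable lebesgue. wnorm p (\<lambda>x. u (- x)) (\<lambda>x. ennreal \<bar>f x\<bar>) \<le> 1}"
      using n[of f] by (auto intro: m)
    then show "wnorm q v (frac_max_plus \<alpha> f)
        \<le> (SUP f\<in>{f \<in> borel_measurable lebesgue. wnorm p (\<lambda>x. u (- x)) (\<lambda>x. ennreal \<bar>f x\<bar>) \<le> 1}.
            wnorm q (\<lambda>x. v (- x)) (frac_max_minus \<alpha> f))"
      using w[of f] by (intro SUP_upper2) auto
  qed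
qed

theorem theorem3p5:
  fixes \<alpha> p q :: real
  assumes "0 < \<alpha>" and "\<alpha> < 1" and "1 < p" and "p < 1 / \<alpha>"
    and "1 / p - 1 / q - \<alpha> = 0"
  shows "((\<exists>c::real. c > 0 \<and> (\<forall>w \<in> Apq_plus p q.
            op_norm p (\<lambda>x. w x powr p) q (\<lambda>x. w x powr q) (frac_max_plus \<alpha>)
              \<le> ennreal c * ennpow (Apq_plus_char p q w) (conj_exp p / q * (1 - \<alpha>))))
       \<and> \<not> (\<exists>\<psi>::real \<Rightarrow> real. (\<forall>t\<ge>1. \<psi> t > 0) \<and> mono_on {1..} \<psi>
            \<and> ((\<lambda>t. \<psi> t / t powr (conj_exp p / q * (1 - \<alpha>))) \<longlongrightarrow> 0) at_top
            \<and> (\<forall>w \<in> Apq_plus p q.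
                 op_norm p (\<lambda>x. w x powr p) q (\<lambda>x. w x powr q) (frac_max_plus \<alpha>)
                   \<le> ennreal (\<psi> (enn2real (Apq_plus_char p q w))))))
    \<and> ((\<exists>c::real. c > 0 \<and> (\<forall>w \<in> Apq_minus p q.
            op_norm p (\<lambda>x. w x powr p) q (\<lambda>x. w x powr q) (frac_max_minus \<alpha>)
              \<le> ennreal c * ennpow (Apq_minus_char p q w) (conj_exp p / q * (1 - \<alpha>))))
       \<and> \<not> (\<exists>\<psi>::real \<Rightarrow> real. (\<forall>t\<ge>1. \<psi> t > 0) \<and> mono_on {1..} \<psi>
            \<and> ((\<lambda>t. \<psi> t / t powr (conj_exp p / q * (1 - \<alpha>))) \<longlongrightarrow> 0) at_top
            \<and> (\<forall>w \<in> Apq_minus p q.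
                 op_norm p (\<lambda>x. w x powr p) q (\<lambda>x. w x powr q) (frac_max_minus \<alpha>)
                   \<le> ennreal (\<psi> (enn2real (Apq_minus_char p q w))))))"
proof -
  let ?\<gamma> = "conj_exp p / q * (1 - \<alpha>)"
  define m where "m = q / conj_exp p"
  have "1 / q = 1 / p - \<alpha>" "\<alpha> < 1 / p" using assms by (simp_all add: field_simps)
  then have q: "0 < q" by (metis diff_gt_0_iff_gt zero_less_divide_1_iff)
  have p': "0 < conj_exp p" using assms by (simp add: conj_exp_def)
  have m: "0 < m" using q p' by (simp add: m_def)
  have \<gamma>: "?\<gamma> = (1 - \<alpha>) / m" by (simp add: m_def)
  \<comment> \<open>Unification supplies for \<open>c\<close> the explicit constant of
    \<open>frac_max_plus_bound\<close>, which contains neither \<open>w\<close> nor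
    \<open>f\<close>.\<close>
  obtain c where c: "c \<ge> 0" and bound: "\<And>w f. w \<in> Apq_plus p q \<Longrightarrow> f \<in> borel_measurable lebesgue \<Longrightarrow>
      wnorm p (\<lambda>x. w x powr p) (\<lambda>x. ennreal \<bar>f x\<bar>) \<le> 1 \<Longrightarrow>
      wnorm q (\<lambda>x. w x powr q) (frac_max_plus \<alpha> f) \<le> ennreal c * ennpow (Apq_plus_char p q w) ?\<gamma>"
    by (rule that[rotated], rule frac_max_plus_bound[OF assms]) auto
  \<comment> \<open>\<open>c + 1\<close> because a positive constant is demanded and only
    \<open>c \<ge> 0\<close> is at hand.\<close>
  have plus: "op_norm p (\<lambda>x. w x powr p) q (\<lambda>x. w x powr q) (frac_max_plus \<alpha>)
      \<le> ennreal (c + 1) * ennpow (Apq_plus_char p q w) ?\<gamma>" if w: "w \<in> Apq_plus p q" for w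
    unfolding op_norm_def
  proof (rule SUP_least)
    fix f assume f: "f \<in> {f \<in> borel_measurable lebesgue. wnorm p (\<lambda>x. w x powr p) (\<lambda>x. ennreal \<bar>f x\<bar>) \<le> 1}"
    have "wnorm q (\<lambda>x. w x powr q) (frac_max_plus \<alpha> f) \<le> ennreal c * ennpow (Apq_plus_char p q w) ?\<gamma>"
      using bound w f by blast
    also have "\<dots> \<le> ennreal (c + 1) * ennpow (Apq_plus_char p q w) ?\<gamma>"
      by (intro mult_right_mono ennreal_leI) auto
    finally show "wnorm q (\<lambda>x. w x powr q) (frac_max_plus \<alpha> f) \<le> \<dots>" .
  qed
  have norm_eq: "op_norm p (\<lambda>x. w (- x) powr p) q (\<lambda>x. w (- x) powr q) (frac_max_minus \<alpha>)
      = op_norm p (\<lambda>x. w x powr p) q (\<lambda>x. w x powr q) (frac_max_plus \<alpha>)" for w :: "real \<Rightarrow> real"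
    by (rule op_norm_minus_reflect)
  have minus: "op_norm p (\<lambda>x. w x powr p) q (\<lambda>x. w x powr q) (frac_max_minus \<alpha>)
      \<le> ennreal (c + 1) * ennpow (Apq_minus_char p q w) ?\<gamma>" if w: "w \<in> Apq_minus p q" for w
    using plus[of "\<lambda>x. w (- x)"] w norm_eq[of "\<lambda>x. w (- x)"]
      Apq_minus_reflect_iff[of "\<lambda>x. w (- x)" p q] Apq_minus_char_reflect[of p q "\<lambda>x. w (- x)"]
    by simp
  define k where "k = 2 powr - (1 - \<alpha>) * (p / q) powr (1 / q)"
  have k: "0 < k" using assms q by (simp add: k_def)
  have fam: "\<exists>w\<in>Apq_plus p q. ennreal (d powr - m / (1 + m)) \<le> Apq_plus_char p q w
    \<and> Apq_plus_char p q w \<le> ennreal ((6 / d) powr m)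
    \<and> ennreal (k * d powr - (1 - \<alpha>)) \<le> op_norm p (\<lambda>x. w x powr p) q (\<lambda>x. w x powr q) (frac_max_plus \<alpha>)"
    if "0 < d" "d < 1" for d
    using power_weight_extremal[OF assms that] unfolding m_def k_def .
  have fam': "\<exists>w\<in>Apq_minus p q. ennreal (d powr - m / (1 + m)) \<le> Apq_minus_char p q w
    \<and> Apq_minus_char p q w \<le> ennreal ((6 / d) powr m)
    \<and> ennreal (k * d powr - (1 - \<alpha>)) \<le> op_norm p (\<lambda>x. w x powr p) q (\<lambda>x. w x powr q) (frac_max_minus \<alpha>)"
    if d: "0 < d" "d < 1" for d
  proof -
    obtain w where "w\<in>Apq_plus p q" "ennreal (d powr - m / (1 + m)) \<le> Apq_plus_char p q w"
      "Apq_plus_char p q w \<le> ennreal ((6 / d) powr m)"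
      "ennreal (k * d powr - (1 - \<alpha>)) \<le> op_norm p (\<lambda>x. w x powr p) q (\<lambda>x. w x powr q) (frac_max_plus \<alpha>)"
      using fam[OF d] by blast
    then show ?thesis
      by (intro bexI[of _ "\<lambda>x. w (- x)"]) (simp_all only: Apq_minus_reflect_iff Apq_minus_char_reflect norm_eq simp_thms)
  qed
  have a: "0 < 1 - \<alpha>" using assms by simp
  show ?thesis
    using plus minus c no_slower_rate[OF m a k \<gamma> fam] no_slower_rate[OF m a k \<gamma> fam']
    by (intro conjI exI[of _ "c + 1"] ballI) auto
qed

end
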